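(* Let $1\le k\le n$, and let $\psi$, $\Gamma$, $\Omega$, $\underline{u}$, $\Gamma_\epsilon$, $\Omega_\epsilon$ be as in the context: in particular $0<\psi(x,u)\in C^\infty(\mathbb{H}^{n+1})$ and $\underline{u}\in C^4(\Omega)\cap C^0(\overline\Omega)$ is admissible with $f(\kappa[\underline u])\ge\psi(x,\underline u)$ in $\Omega$ and $\underline u=0$ on $\Gamma$. If $k<n$, suppose moreover that (a) $\psi_u-\frac{\psi}{u}\ge 0$ on $\mathbb{H}^{n+1}$; (b) $-\lambda(D^2\underline{u})\in\Gamma_{k+1}$ near $\Gamma$ ($\lambda$ denoting eigenvalues); (c) for all sufficiently small $\epsilon>0$ the compatibility conditions (defined in the context) hold at $\epsilon$. Let $u\in C^{0,1}_{loc}(\Omega)\cap C^0(\overline\Omega)$ be the locally uniform limit in $\Omega$, along a sequence $\epsilon\searrow0$, of admissible solutions $u^\epsilon\in C^\infty(\overline{\Omega_\epsilon})$, $u^\epsilon\ge\underline u$, of $$f(\kappa[u^\epsilon])=\psi(x,u^\epsilon)\ \text{ in }\Omega_\epsilon,\qquad u^\epsilon=\epsilon\ \text{ on }\Gamma_\epsilon .$$ Then $u$ is a viscosity solution of $G(D^2u,Du,u)=\psi(x,u)$ in $\Omega$.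
   Context: Half-space model: $\mathbb{H}^{n+1}=\{(x,x_{n+1})\in\mathbb{R}^{n+1}: x_{n+1}>0\}$ with metric $x_{n+1}^{-2}\sum_{i=1}^{n+1}dx_i^2$. For a positive $C^2$ function $u$ on (a subset of) $\mathbb{R}^n$ put $w=\sqrt{1+|Du|^2}$, $\gamma^{ik}=\delta_{ik}-\frac{u_iu_k}{w(1+w)}$, $a_{ij}[u]=\frac1w(\delta_{ij}+u\gamma^{ik}u_{kl}\gamma^{lj})$ (sum over repeated indices). $\kappa[u]=(\kappa_1,\dots,\kappa_n)$, the eigenvalues of $(a_{ij}[u])$, are the hyperbolic principal curvatures of the graph of $u$ with respect to the upward normal. $\sigma_j(\kappa)=\sum_{i_1<\dots<i_j}\kappa_{i_1}\cdots\kappa_{i_j}$, $\Gamma_j=\{\kappa\in\mathbb{R}^n:\sigma_1(\kappa)>0,\dots,\sigma_j(\kappa)>0\}$, $f=\sigma_k^{1/k}$, and $G(D^2u,Du,u)=f(\kappa[u])$. A positive $C^2$ function $u$ is admissible at a point if $\kappa[u]\in\Gamma_k$ there, and admissible if this holds at every point. The function $\psi$ is written $\psi(x,u)$ with $x\in\mathbb{R}^n$, $u>0$, and $\psi_u$ is its partial derivative in the last variable. Viscosity solutions. A function $0<u\in C^0(\Omega)$ is a viscosity subsolution of $G(D^2u,Du,u)=\psi(x,u)$ in $\Omega$ if for any $\phi\in C^2(\Omega)$ and any $x_0\in\Omega$ with $u(x_0)=\phi(x_0)$ and $u\le\phi$ in a neighborhood of $x_0$, one has $G(D^2\phi,D\phi,\phi)(x_0)\ge\psi(x_0,\phi(x_0))$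 (the inequality being understood to include that $\sigma_k(\kappa[\phi])(x_0)\ge0$, so that the $k$-th root makes sense). It is a viscosity supersolution if for any $\phi\in C^2(\Omega)$ and any $x_0\in\Omega$ with $u(x_0)=\phi(x_0)$ and $u\ge\phi$ in a neighborhood of $x_0$, either $\phi$ is not admissible at $x_0$ or $G(D^2\phi,D\phi,\phi)(x_0)\le\psi(x_0,\phi(x_0))$. A viscosity solution is a function that is both. $\Gamma=\{\Gamma_1,\dots,\Gamma_m\}$ is a disjoint collection of smooth closed $(n-1)$-dimensional submanifolds of $\mathbb{R}^n\times\{0\}=\partial_\infty\mathbb{H}^{n+1}$, and $\Omega$ is the bounded domain in $\mathbb{R}^n$ enclosed by $\Gamma$. For $\epsilon>0$, $\Gamma_\epsilon=\{x\in\Omega:\underline u(x)=\epsilon\}$ and $\Omega_\epsilon=\{x\in\Omega:\underline u(x)>\epsilon\}$. Standing assumption: for all sufficiently small $\epsilon>0$, $\Gamma_\epsilon$ is a regular boundary of $\Omega_\epsilon$, i.e. $\Gamma_\epsilon$ is $(n-1)$-dimensional, of class $C^4$, and $\underline u_\gamma=|D\underline u|>0$ on $\Gamma_\epsilon$, where $\gamma$ is the unit interior normal to $\Gamma_\epsilon$. Compatibility conditions at $\epsilon$. Let $\delta>0$ be a small constant with $f(\kappa[\underline u])>\delta\,\underline u$ in $\Omega_\epsilon$. For $t\in[0,1]$ consider, with boundary condition $u=\epsilon$ on $\Gamma_\epsilon$, the two equations in $\Omega_\epsilon$ $$(P_t)\quad f(\kappa[u])=\Big((1-t)\tfrac{f(\kappa[\underline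 u])(x)}{\underline u(x)}+t\delta\Big)u,\qquad (Q_t)\quad f(\kappa[u])=(1-t)\delta u+t\,\psi(x,u).$$ Let $r_0^\epsilon\in(0,\infty]$ be the maximal radius of exterior spheres to $\Gamma_\epsilon$ in $\mathbb{R}^n$. The conditions hold at $\epsilon$ if there is a constant $\sigma\in(0,1)$ (possibly depending on $\epsilon$) such that for every $t\in[0,1]$ and every admissible solution $u\ge\underline u$ of $(P_t)$ or of $(Q_t)$, the right-hand side of the equation, evaluated at $u$, is $>\sigma_k^{1/k}(\sigma,\dots,\sigma)$ on $\overline{\Omega_\epsilon}$, and $$0<\epsilon<r_0^\epsilon\sigma,\qquad \sigma-\frac{\sqrt{1-\sigma^2}}{r_0^\epsilon}\,\epsilon-\frac{1+\sigma}{(r_0^\epsilon)^2}\,\epsilon^2>0$$ (terms with $r_0^\epsilon=\infty$ in the denominator are $0$). *)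

theory Defs
  imports "HOL-Analysis.Analysis"
begin

section \<open>Function spaces\<close>

text \<open>All uses are with an open set \<open>S\<close>; the values of \<open>f\<close> outside \<open>S\<close> are then irrelevant.\<close>

primrec Ck_on :: "nat \<Rightarrow> 'a::euclidean_space set \<Rightarrow> ('a \<Rightarrow> 'b::real_normed_vector) \<Rightarrow> bool" where
  "Ck_on 0 S f \<longleftrightarrow> continuous_on S f"
| "Ck_on (Suc k) S f \<longleftrightarrow> (\<forall>x\<in>S. f differentiable (at x)) \<and>
     (\<forall>b\<in>Basis. Ck_on k S (\<lambda>x. frechet_derivative f (at x) b))"

definition C_on :: "enat \<Rightarrow> 'a::euclidean_space set \<Rightarrow> ('a \<Rightarrow> 'b::real_normed_vector) \<Rightarrow> bool" where
  "C_on r S f \<longleftrightarrow> (\<forall>k. enat k \<le> r \<longrightarrow> Ck_on k S f)"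

text \<open>\<open>C\<^sup>k\<close> up to the boundary: all derivatives of order at most \<open>k\<close> on the open set \<open>S\<close> extend
  continuously to the closure of \<open>S\<close>.\<close>

primrec Ck_ext :: "nat \<Rightarrow> 'a::euclidean_space set \<Rightarrow> ('a \<Rightarrow> 'b::real_normed_vector) \<Rightarrow> bool" where
  "Ck_ext 0 S f \<longleftrightarrow> (\<exists>g. continuous_on (closure S) g \<and> (\<forall>x\<in>S. g x = f x))"
| "Ck_ext (Suc k) S f \<longleftrightarrow> (\<exists>g. continuous_on (closure S) g \<and> (\<forall>x\<in>S. g x = f x)) \<and>
     (\<forall>x\<in>S. f differentiable (at x)) \<and>
     (\<forall>b\<in>Basis. Ck_ext k S (\<lambda>x. frechet_derivative f (at x) b))"

text \<open>The first conjunct makes the values of \<open>f\<close> on the boundary the continuous extension of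
  those in the interior, so that boundary conditions can be imposed on \<open>f\<close> itself.\<close>

definition smooth_on_closure :: "'a::euclidean_space set \<Rightarrow> ('a \<Rightarrow> 'b::real_normed_vector) \<Rightarrow> bool" where
  "smooth_on_closure S f \<longleftrightarrow> continuous_on (closure S) f \<and> (\<forall>k. Ck_ext k S f)"

definition loc_lipschitz :: "'a::metric_space set \<Rightarrow> ('a \<Rightarrow> 'b::metric_space) \<Rightarrow> bool" where
  "loc_lipschitz S f \<longleftrightarrow> (\<forall>K. compact K \<and> K \<subseteq> S \<longrightarrow> (\<exists>L. L-lipschitz_on K f))"

definition loc_uniform_limit ::
    "'a::metric_space set \<Rightarrow> (nat \<Rightarrow> 'a \<Rightarrow> 'b::metric_space) \<Rightarrow> ('a \<Rightarrow> 'b) \<Rightarrow> bool" where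
  "loc_uniform_limit S v u \<longleftrightarrow> (\<forall>K. compact K \<and> K \<subseteq> S \<longrightarrow> uniform_limit K v u sequentially)"

section \<open>Hypersurfaces and the domain they enclose\<close>

text \<open>Embedded \<open>C\<^sup>r\<close> submanifolds of codimension one, by slice charts.\<close>

definition hypersurface :: "enat \<Rightarrow> (real^'n) set \<Rightarrow> bool" where
  "hypersurface r S \<longleftrightarrow> (\<forall>p\<in>S. \<exists>U V (\<Phi> :: real^'n \<Rightarrow> real^'n) \<Psi> i. open U \<and> p \<in> U \<and> open V \<and>
     homeomorphism U V \<Phi> \<Psi> \<and> C_on r U \<Phi> \<and> C_on r V \<Psi> \<and>
     \<Phi> ` (S \<inter> U) = V \<inter> {y. y $ i = 0})"

text \<open>The ideal boundary is identified with \<open>real^'n\<close>, dropping the last coordinate \<open>0\<close>.\<close>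

definition encloses :: "(real^'n) set set \<Rightarrow> (real^'n) set \<Rightarrow> bool" where
  "encloses \<Gamma> \<Omega> \<longleftrightarrow> finite \<Gamma> \<and> disjoint \<Gamma> \<and> (\<forall>S\<in>\<Gamma>. compact S \<and> hypersurface \<infinity> S) \<and>
     open \<Omega> \<and> connected \<Omega> \<and> bounded \<Omega> \<and> \<Omega> \<noteq> {} \<and> frontier \<Omega> = \<Union>\<Gamma>"

definition halfspace :: "((real^'n) \<times> real) set" where
  "halfspace = {p. snd p > 0}"

section \<open>Hyperbolic principal curvatures of a graph\<close>

definition partial :: "'n \<Rightarrow> (real^'n \<Rightarrow> real) \<Rightarrow> real^'n \<Rightarrow> real" where
  "partial i u x = frechet_derivative u (at x) (axis i 1)"

definition grad :: "(real^'n \<Rightarrow> real) \<Rightarrow> real^'n \<Rightarrow> real^'n" where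
  "grad u x = (\<chi> i. partial i u x)"

definition hess :: "(real^'n \<Rightarrow> real) \<Rightarrow> real^'n \<Rightarrow> real^'n^'n" where
  "hess u x = (\<chi> i j. partial j (partial i u) x)"

text \<open>The eigenvalues counted with algebraic multiplicity, listed in an arbitrary order; only
  symmetric functions of them are used. Meaningful for matrices whose eigenvalues are all real, in
  particular for symmetric ones. Note that \<open>mat t\<close> is \<open>t\<close> times the identity.\<close>

definition eigvals :: "real^'n^'n \<Rightarrow> real^'n" where
  "eigvals A = (SOME \<kappa>. \<forall>t. det (mat t - A) = (\<Prod>i\<in>UNIV. t - \<kappa> $ i))"

definition esym :: "nat \<Rightarrow> real^'n \<Rightarrow> real" where
  "esym j \<kappa> = (\<Sum>I | card I = j. \<Prod>i\<in>I. \<kappa> $ i)"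

definition garding_cone :: "nat \<Rightarrow> (real^'n) set" where
  "garding_cone j = {\<kappa>. \<forall>i\<in>{1..j}. esym i \<kappa> > 0}"

text \<open>\<open>root k\<close> is odd on negative arguments, so \<open>curv_fun\<close> is \<open>\<sigma>\<^sub>k\<close> to the power \<open>1/k\<close> only where
  \<open>\<sigma>\<^sub>k\<close> is nonnegative.\<close>

definition curv_fun :: "nat \<Rightarrow> real^'n \<Rightarrow> real" where
  "curv_fun k \<kappa> = root k (esym k \<kappa>)"

text \<open>The matrix \<open>a\<^sub>i\<^sub>j\<close> as a function of \<open>H = D\<^sup>2u\<close>, \<open>p = Du\<close> and \<open>z = u\<close>.\<close>

definition wfac :: "real^'n \<Rightarrow> real" where
  "wfac p = sqrt (1 + (norm p)\<^sup>2)"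

definition gam :: "real^'n \<Rightarrow> real^'n^'n" where
  "gam p = (\<chi> i j. (if i = j then 1 else 0) - p $ i * p $ j / (wfac p * (1 + wfac p)))"

definition curv_matrix :: "real^'n^'n \<Rightarrow> real^'n \<Rightarrow> real \<Rightarrow> real^'n^'n" where
  "curv_matrix H p z = (\<chi> i j. 1 / wfac p *
     ((if i = j then 1 else 0) +
      z * (\<Sum>k\<in>UNIV. \<Sum>l\<in>UNIV. gam p $ i $ k * H $ k $ l * gam p $ l $ j)))"

definition kappa :: "(real^'n \<Rightarrow> real) \<Rightarrow> real^'n \<Rightarrow> real^'n" where
  "kappa u x = eigvals (curv_matrix (hess u x) (grad u x) (u x))"

definition G :: "nat \<Rightarrow> real^'n^'n \<Rightarrow> real^'n \<Rightarrow> real \<Rightarrow> real" where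
  "G k H p z = curv_fun k (eigvals (curv_matrix H p z))"

definition admissible_at :: "nat \<Rightarrow> (real^'n \<Rightarrow> real) \<Rightarrow> real^'n \<Rightarrow> bool" where
  "admissible_at k u x \<longleftrightarrow> 0 < u x \<and> kappa u x \<in> garding_cone k"

definition admissible_on :: "nat \<Rightarrow> (real^'n) set \<Rightarrow> (real^'n \<Rightarrow> real) \<Rightarrow> bool" where
  "admissible_on k D u \<longleftrightarrow> C_on 2 D u \<and> (\<forall>x\<in>D. admissible_at k u x)"

section \<open>Viscosity solutions\<close>

text \<open>The conjunct on \<open>esym\<close> makes explicit that the \<open>k\<close>-th root is taken of a nonnegative number.\<close>

definition viscosity_subsolution ::
    "nat \<Rightarrow> ((real^'n) \<times> real \<Rightarrow> real) \<Rightarrow> (real^'n) set \<Rightarrow> (real^'n \<Rightarrow> real) \<Rightarrow> bool" where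
  "viscosity_subsolution k \<psi> \<Omega> u \<longleftrightarrow>
     continuous_on \<Omega> u \<and> (\<forall>x\<in>\<Omega>. 0 < u x) \<and>
     (\<forall>\<phi>. C_on 2 \<Omega> \<phi> \<longrightarrow>
       (\<forall>x\<^sub>0\<in>\<Omega>. u x\<^sub>0 = \<phi> x\<^sub>0 \<and> (\<forall>\<^sub>F x in nhds x\<^sub>0. u x \<le> \<phi> x) \<longrightarrow>
         0 \<le> esym k (kappa \<phi> x\<^sub>0) \<and>
         G k (hess \<phi> x\<^sub>0) (grad \<phi> x\<^sub>0) (\<phi> x\<^sub>0) \<ge> \<psi> (x\<^sub>0, \<phi> x\<^sub>0)))"

definition viscosity_supersolution ::
    "nat \<Rightarrow> ((real^'n) \<times> real \<Rightarrow> real) \<Rightarrow> (real^'n) set \<Rightarrow> (real^'n \<Rightarrow> real) \<Rightarrow> bool" where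
  "viscosity_supersolution k \<psi> \<Omega> u \<longleftrightarrow>
     continuous_on \<Omega> u \<and> (\<forall>x\<in>\<Omega>. 0 < u x) \<and>
     (\<forall>\<phi>. C_on 2 \<Omega> \<phi> \<longrightarrow>
       (\<forall>x\<^sub>0\<in>\<Omega>. u x\<^sub>0 = \<phi> x\<^sub>0 \<and> (\<forall>\<^sub>F x in nhds x\<^sub>0. u x \<ge> \<phi> x) \<longrightarrow>
         \<not> admissible_at k \<phi> x\<^sub>0 \<or>
         G k (hess \<phi> x\<^sub>0) (grad \<phi> x\<^sub>0) (\<phi> x\<^sub>0) \<le> \<psi> (x\<^sub>0, \<phi> x\<^sub>0)))"

definition viscosity_solution ::
    "nat \<Rightarrow> ((real^'n) \<times> real \<Rightarrow> real) \<Rightarrow> (real^'n) set \<Rightarrow> (real^'n \<Rightarrow> real) \<Rightarrow> bool" where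
  "viscosity_solution k \<psi> \<Omega> u \<longleftrightarrow>
     viscosity_subsolution k \<psi> \<Omega> u \<and> viscosity_supersolution k \<psi> \<Omega> u"

section \<open>The approximating Dirichlet problems\<close>

definition level :: "(real^'n) set \<Rightarrow> (real^'n \<Rightarrow> real) \<Rightarrow> real \<Rightarrow> (real^'n) set" where
  "level \<Omega> ul \<epsilon> = {x\<in>\<Omega>. ul x = \<epsilon>}"

definition superlevel :: "(real^'n) set \<Rightarrow> (real^'n \<Rightarrow> real) \<Rightarrow> real \<Rightarrow> (real^'n) set" where
  "superlevel \<Omega> ul \<epsilon> = {x\<in>\<Omega>. ul x > \<epsilon>}"

text \<open>The unit interior normal to the level set is the normalised gradient, so the normal derivative
  of \<open>ul\<close> is the norm of its gradient.\<close>

definition regular_level :: "(real^'n) set \<Rightarrow> (real^'n \<Rightarrow> real) \<Rightarrow> real \<Rightarrow> bool" where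
  "regular_level \<Omega> ul \<epsilon> \<longleftrightarrow>
     frontier (superlevel \<Omega> ul \<epsilon>) = level \<Omega> ul \<epsilon> \<and>
     hypersurface 4 (level \<Omega> ul \<epsilon>) \<and>
     (\<forall>x\<in>level \<Omega> ul \<epsilon>. norm (grad ul x) > 0)"

text \<open>\<open>u\<close> solves \<open>f(\<kappa>[u]) = rhs(x,u)\<close> in \<open>superlevel \<Omega> ul \<epsilon>\<close>, \<open>u = \<epsilon>\<close> on \<open>level \<Omega> ul \<epsilon>\<close>, and
  \<open>u \<ge> ul\<close>. Admissibility includes \<open>C\<^sup>2\<close> regularity in the interior.\<close>

definition admissible_solution_above ::
    "nat \<Rightarrow> (real^'n) set \<Rightarrow> (real^'n \<Rightarrow> real) \<Rightarrow> real \<Rightarrow> (real^'n \<Rightarrow> real \<Rightarrow> real) \<Rightarrow>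
     (real^'n \<Rightarrow> real) \<Rightarrow> bool" where
  "admissible_solution_above k \<Omega> ul \<epsilon> rhs u \<longleftrightarrow>
     admissible_on k (superlevel \<Omega> ul \<epsilon>) u \<and>
     continuous_on (closure (superlevel \<Omega> ul \<epsilon>)) u \<and>
     (\<forall>x\<in>superlevel \<Omega> ul \<epsilon>. curv_fun k (kappa u x) = rhs x (u x)) \<and>
     (\<forall>x\<in>level \<Omega> ul \<epsilon>. u x = \<epsilon>) \<and>
     (\<forall>x\<in>closure (superlevel \<Omega> ul \<epsilon>). ul x \<le> u x)"

text \<open>The largest \<open>r\<close> such that every boundary point of \<open>D\<close> is touched by a sphere of radius \<open>r\<close>
  bounding a ball outside \<open>D\<close>; possibly \<open>\<infinity>\<close>.\<close>

definition exterior_radius :: "(real^'n) set \<Rightarrow> ereal" where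
  "exterior_radius D =
     Sup {ereal r | r. 0 < r \<and> (\<forall>p\<in>frontier D. \<exists>c. dist c p = r \<and> ball c r \<inter> D = {})}"

definition rhs_P ::
    "nat \<Rightarrow> (real^'n \<Rightarrow> real) \<Rightarrow> real \<Rightarrow> real \<Rightarrow> real^'n \<Rightarrow> real \<Rightarrow> real" where
  "rhs_P k ul \<delta> t x z = ((1 - t) * (curv_fun k (kappa ul x) / ul x) + t * \<delta>) * z"

definition rhs_Q ::
    "((real^'n) \<times> real \<Rightarrow> real) \<Rightarrow> real \<Rightarrow> real \<Rightarrow> real^'n \<Rightarrow> real \<Rightarrow> real" where
  "rhs_Q \<psi> \<delta> t x z = (1 - t) * \<delta> * z + t * \<psi> (x, z)"

text \<open>\<open>\<delta>\<close> and \<open>\<sigma>\<close> may depend on \<open>\<epsilon>\<close>. The number \<open>\<rho>\<close> is \<open>1/r\<^sub>0\<close>, which is \<open>0\<close> if \<open>r\<^sub>0 = \<infinity>\<close>.\<close>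

definition compatible_at ::
    "nat \<Rightarrow> ((real^'n) \<times> real \<Rightarrow> real) \<Rightarrow> (real^'n) set \<Rightarrow> (real^'n \<Rightarrow> real) \<Rightarrow> real \<Rightarrow> bool" where
  "compatible_at k \<psi> \<Omega> ul \<epsilon> \<longleftrightarrow>
     (\<exists>\<delta>>0. (\<forall>x\<in>superlevel \<Omega> ul \<epsilon>. curv_fun k (kappa ul x) > \<delta> * ul x) \<and>
       (\<exists>\<sigma>. 0 < \<sigma> \<and> \<sigma> < 1 \<and>
         (\<forall>t\<in>{0..1}. \<forall>rhs\<in>{rhs_P k ul \<delta> t, rhs_Q \<psi> \<delta> t}. \<forall>u.
            admissible_solution_above k \<Omega> ul \<epsilon> rhs u \<longrightarrow>
            (\<forall>x\<in>closure (superlevel \<Omega> ul \<epsilon>). rhs x (u x) > curv_fun k (\<chi> i::'n. \<sigma>))) \<and>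
         (let r\<^sub>0 = exterior_radius (superlevel \<Omega> ul \<epsilon>);
              \<rho> = real_of_ereal (inverse r\<^sub>0)
          in 0 < \<epsilon> \<and> ereal \<epsilon> < r\<^sub>0 * ereal \<sigma> \<and>
             \<sigma> - sqrt (1 - \<sigma>\<^sup>2) * \<rho> * \<epsilon> - (1 + \<sigma>) * \<rho>\<^sup>2 * \<epsilon>\<^sup>2 > 0)))"

end

theory Submission
  imports Defs "HOL-Computational_Algebra.Fundamental_Theorem_Algebra"
begin

text \<open>
Viscosity solutions of a degenerate elliptic equation are stable under locally uniform convergence, and
the proof is an instance of that principle. The domains \<open>{ul > \<epsilon>}\<close> exhaust \<open>\<Omega>\<close> as \<open>\<epsilon>\<close> decreases to \<open>0\<close>
because \<open>ul\<close> is positive in \<open>\<Omega>\<close>, and \<open>u \<ge> ul\<close> keeps the limit positive. If a test function \<open>\<phi>\<close> touches \<open>u\<close>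
from above at \<open>x\<^sub>0\<close>, then \<open>v - \<phi> - \<delta>\<bar>x - x\<^sub>0\<bar>\<^sup>2\<close> has for a late approximant \<open>v\<close> a local maximum at a point \<open>y\<close>
near \<open>x\<^sub>0\<close> (\<open>penalized_maximum\<close>). There the gradients agree up to \<open>O(\<delta>)\<close> and \<open>D\<^sup>2v \<le> D\<^sup>2\<phi> + 2\<delta>\<close>
(\<open>touching_derivatives\<close>). Since \<open>v\<close> solves the equation classically, ellipticity turns this into an inequality for \<open>\<phi>\<close>
at \<open>y\<close> up to a small error, and continuity gives the inequality at \<open>x\<^sub>0\<close> as \<open>\<delta> \<rightarrow> 0\<close>. Touching from below
is symmetric; there the Hessian of \<open>\<phi>\<close> is the smaller one, which is why \<open>\<phi>\<close> has to be admissible at \<open>x\<^sub>0\<close>.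

The substance is ellipticity: if \<open>A\<close> is symmetric with eigenvalues in \<open>\<Gamma>\<^sub>k\<close> and \<open>C\<close> is positive semidefinite, then
\<open>\<sigma>\<^sub>k(A + C) \<ge> \<sigma>\<^sub>k(A)\<close> (\<open>minor_sum_mono\<close>). By the spectral theorem \<open>C\<close> is a sum of matrices \<open>c v v\<^sup>T\<close> with
\<open>c \<ge> 0\<close>, and in an eigenbasis of \<open>A\<close> adding one of them changes \<open>\<sigma>\<^sub>k\<close> exactly by \<open>c \<Sum>\<^sub>i w\<^sub>i\<^sup>2 \<sigma>\<^bsub>k-1\<^esub>(\<lambda>|i)\<close>, where
\<open>w\<close> are the coordinates of \<open>v\<close> and \<open>\<lambda>|i\<close> is \<open>\<lambda>\<close> without its \<open>i\<close>-th entry. These coefficients are positive on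
\<open>\<Gamma>\<^sub>k\<close> (\<open>garding_remove\<close>) by Newton's inequality for polynomials with only real roots
(\<open>real_split_newton\<close>), which follows from Laguerre's inequality and the fact that differentiation preserves
real-rootedness.

The symmetric functions of the eigenvalues are handled as sums of principal minors (\<open>minor_sum\<close>). These are
polynomials in the matrix entries, so their continuity is evident although the eigenvalues themselves are
only chosen in some order.
\<close>

section \<open>Real-rooted polynomials and Newton's inequality\<close>

text \<open>The nonzero real polynomials all of whose complex roots are real, given by their affine factors. The
factors \<open>[:a, b:]\<close> are not normalised to be monic, so that \<open>1 + \<lambda> x\<close> is a factor also for \<open>\<lambda> = 0\<close>.\<close>

inductive real_split :: "real poly \<Rightarrow> bool" where
  const: "c \<noteq> 0 \<Longrightarrow> real_split [:c:]"
| factor: "[:a, b:] \<noteq> 0 \<Longrightarrow> real_split q \<Longrightarrow> real_split ([:a, b:] * q)"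

lemma real_split_nonzero: "real_split q \<Longrightarrow> q \<noteq> 0"
  by (induction rule: real_split.induct) (auto simp del: mult_pCons_left)

lemma coeff_linear_mult:
  fixes q :: "'a::comm_ring_1 poly"
  shows "coeff ([:a, b:] * q) 0 = a * coeff q 0"
    and "coeff ([:a, b:] * q) (Suc j) = a * coeff q (Suc j) + b * coeff q j"
  by simp_all

text \<open>Up to a constant factor, \<open>q = \<Prod>(a\<^sub>i + b\<^sub>i x)\<close>, and the difference of the two sides is
\<open>q'(0)\<^sup>2 - q(0) q''(0) = \<Sum>\<^sub>i b\<^sub>i\<^sup>2 \<Prod>\<^bsub>l\<noteq>i\<^esub> a\<^sub>l\<^sup>2\<close>; the induction adds one square at a time.\<close>

lemma real_split_laguerre:
  assumes "real_split q"
  shows "2 * coeff q 0 * coeff q 2 \<le> (coeff q 1)\<^sup>2"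
  using assms
proof (induction rule: real_split.induct)
  case (const c)
  then show ?case by (simp add: numeral_2_eq_2)
next
  case (factor a b q)
  have "(coeff ([:a, b:] * q) 1)\<^sup>2 - 2 * coeff ([:a, b:] * q) 0 * coeff ([:a, b:] * q) 2
      = a\<^sup>2 * ((coeff q 1)\<^sup>2 - 2 * coeff q 0 * coeff q 2) + b\<^sup>2 * (coeff q 0)\<^sup>2"
    unfolding numeral_2_eq_2 One_nat_def coeff_linear_mult
    by (simp add: algebra_simps power2_eq_square)
  moreover have "\<dots> \<ge> 0" using factor.IH by simp
  ultimately show ?case by linarith
qed

abbreviation cpoly :: "real poly \<Rightarrow> complex poly" where
  "cpoly \<equiv> map_poly complex_of_real"

lemma cpoly_pderiv: "cpoly (pderiv q) = pderiv (cpoly q)"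
  by (rule poly_eqI) (simp add: coeff_map_poly coeff_pderiv)

lemma cpoly_mult: "cpoly (p * q) = cpoly p * cpoly q"
  by (rule poly_eqI) (simp add: coeff_map_poly coeff_mult)

text \<open>This is the argument of Gauss and Lucas: \<open>q'/q\<close> is the sum of the terms \<open>1/(z - r)\<close> over the roots \<open>r\<close>, and
for real \<open>r\<close> each of them has negative imaginary part in the upper half plane. Multiplication by \<open>\<bar>q\<bar>\<^sup>2\<close>
avoids the division.\<close>

lemma real_split_log_derivative:
  assumes "real_split q" "Im z > 0"
  shows "poly (cpoly q) z \<noteq> 0 \<and> Im (poly (pderiv (cpoly q)) z * cnj (poly (cpoly q) z)) \<le> 0 \<and>
    (degree q > 0 \<longrightarrow> Im (poly (pderiv (cpoly q)) z * cnj (poly (cpoly q) z)) < 0)"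
  using assms(1)
proof (induction rule: real_split.induct)
  case (const c)
  then show ?case by (simp add: map_poly_pCons pderiv_pCons)
next
  case (factor a b q)
  let ?l = "complex_of_real a + of_real b * z"
  let ?Q = "poly (cpoly q) z" and ?Q' = "poly (pderiv (cpoly q)) z"
  have val: "poly (cpoly ([:a, b:] * q)) z = ?l * ?Q"
    by (simp only: cpoly_mult) (simp add: map_poly_pCons algebra_simps)
  have der: "poly (pderiv (cpoly ([:a, b:] * q))) z = of_real b * ?Q + ?l * ?Q'"
    by (simp only: cpoly_mult pderiv_mult)
      (simp add: map_poly_pCons pderiv_pCons algebra_simps)
  have "(of_real b * ?Q + ?l * ?Q') * cnj (?l * ?Q)
      = of_real (b * (cmod ?Q)\<^sup>2) * cnj ?l + of_real ((cmod ?l)\<^sup>2) * (?Q' * cnj ?Q)"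
    unfolding of_real_mult complex_norm_square by (simp add: algebra_simps)
  also have "Im \<dots> = - b\<^sup>2 * (cmod ?Q)\<^sup>2 * Im z + (cmod ?l)\<^sup>2 * Im (?Q' * cnj ?Q)"
    by (simp add: power2_eq_square)
  finally have im: "Im ((of_real b * ?Q + ?l * ?Q') * cnj (?l * ?Q)) = \<dots>" .
  have "?l \<noteq> 0"
  proof
    assume "?l = 0"
    then have "Im ?l = 0" "Re ?l = 0" by simp_all
    then show False using assms(2) factor.hyps by auto
  qed
  have le: "- b\<^sup>2 * (cmod ?Q)\<^sup>2 * Im z \<le> 0" "(cmod ?l)\<^sup>2 * Im (?Q' * cnj ?Q) \<le> 0"
    using factor.IH assms(2) by (auto simp: mult_nonneg_nonpos)
  have "degree ([:a, b:] * q) > 0 \<longrightarrow> b \<noteq> 0 \<or> degree q > 0"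
    by (auto split: if_splits)
  moreover have "- b\<^sup>2 * (cmod ?Q)\<^sup>2 * Im z < 0" if "b \<noteq> 0"
    using that factor.IH assms(2) by simp
  moreover have "(cmod ?l)\<^sup>2 * Im (?Q' * cnj ?Q) < 0" if "degree q > 0"
    using that factor.IH \<open>?l \<noteq> 0\<close> by (simp add: mult_pos_neg)
  ultimately show ?case
    unfolding val der im using \<open>?l \<noteq> 0\<close> factor.IH le by fastforce
qed

text \<open>Nonreal roots of a real polynomial come in conjugate pairs, so that it is enough to exclude the upper
half plane; then real roots are split off one by one.\<close>

lemma real_split_of_real_roots:
  fixes q :: "real poly"
  assumes "q \<noteq> 0" "\<And>z. Im z > 0 \<Longrightarrow> poly (cpoly q) z \<noteq> 0"
  shows "real_split q"
  using assms
proof (induction "degree q" arbitrary: q)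
  case 0
  then show ?case by (metis degree_0_id of_nat_0 pCons_eq_0_iff real_split.const degree_eq_zeroE)
next
  case (Suc d)
  have "\<not> constant (poly (cpoly q))"
    using Suc.hyps(2) by (simp add: constant_degree degree_map_poly)
  then obtain z where z: "poly (cpoly q) z = 0"
    using fundamental_theorem_of_algebra by blast
  have "poly (cpoly q) (cnj z) = cnj (poly (cpoly q) z)"
    by (simp add: poly_altdef coeff_map_poly)
  then have "Im z = 0"
    using Suc.prems(2)[of z] Suc.prems(2)[of "cnj z"] z
    by (metis complex_cnj_zero cnj.sel(2) linorder_neqE_linordered_idom neg_0_less_iff_less)
  then have "z = of_real (Re z)" by (simp add: complex_eq_iff)
  moreover have "poly (cpoly q) (of_real (Re z)) = of_real (poly q (Re z))"
    by (simp add: poly_altdef coeff_map_poly degree_map_poly)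
  ultimately have "poly q (Re z) = 0" using z by (metis of_real_eq_0_iff)
  then obtain p where p: "q = [:- Re z, 1:] * p"
    by (metis poly_eq_0_iff_dvd dvdE)
  then have "p \<noteq> 0" using Suc.prems(1) by auto
  moreover have "d = degree p"
    using Suc.hyps(2) p \<open>p \<noteq> 0\<close> by (simp add: p degree_mult_eq del: mult_pCons_left)
  moreover have "poly (cpoly p) w \<noteq> 0" if "Im w > 0" for w
    using Suc.prems(2)[OF that] unfolding p cpoly_mult by auto
  ultimately have "real_split p" using Suc.hyps(1) by blast
  then show ?case unfolding p by (intro real_split.factor) auto
qed

lemma real_split_pderiv:
  assumes "real_split q" "degree q > 0"
  shows "real_split (pderiv q)"
proof (rule real_split_of_real_roots)
  show "pderiv q \<noteq> 0" using assms(2) by (simp add: pderiv_eq_0_iff)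
  show "poly (cpoly (pderiv q)) z \<noteq> 0" if "Im z > 0" for z
    using real_split_log_derivative[OF assms(1) that] assms(2) by (auto simp: cpoly_pderiv)
qed

text \<open>A weak form of Newton's inequality. The \<open>j\<close>-th derivative of \<open>q\<close> again has only real roots, and
Laguerre's inequality for it at \<open>0\<close> compares the coefficients of index \<open>j\<close>, \<open>j + 1\<close>, \<open>j + 2\<close> of \<open>q\<close>.\<close>

lemma real_split_newton:
  assumes "real_split q"
  shows "coeff q j * coeff q (j + 2) \<le> (coeff q (j + 1))\<^sup>2"
proof -
  (* The sharper constants are the ones that pass from the derivative of q back to q. *)
  have "(real j + 2) * (coeff q j * coeff q (j + 2)) \<le> (real j + 1) * (coeff q (j + 1))\<^sup>2"
    using assms
  proof (induction j arbitrary: q)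
    case 0
    then show ?case using real_split_laguerre[of q] by (simp add: numeral_2_eq_2 mult_ac)
  next
    case (Suc j)
    show ?case
    proof (cases "degree q > 0")
      case True
      let ?x = "coeff q (Suc j)" and ?y = "coeff q (Suc j + 1)" and ?z = "coeff q (Suc j + 2)"
      have "(real j + 2) * ((real j + 1) * ?x * ((real j + 3) * ?z)) \<le> (real j + 1) * ((real j + 2) * ?y)\<^sup>2"
        using Suc.IH[OF real_split_pderiv[OF Suc.prems True]]
        by (simp add: coeff_pderiv add_ac numeral_3_eq_3)
      then have "((real j + 1) * (real j + 2)) * ((real j + 3) * (?x * ?z))
          \<le> ((real j + 1) * (real j + 2)) * ((real j + 2) * ?y\<^sup>2)"
        by (simp add: power2_eq_square mult_ac)
      then have "(real j + 3) * (?x * ?z) \<le> (real j + 2) * ?y\<^sup>2"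
        by (rule mult_left_le_imp_le) (simp add: add_pos_nonneg)
      then show ?thesis by (simp add: add_ac)
    next
      case False
      then have "coeff q (Suc j + 2) = 0" by (intro coeff_eq_0) simp
      then show ?thesis by simp
    qed
  qed
  show ?thesis
  proof (cases "coeff q j * coeff q (j + 2) \<le> 0")
    case True
    then show ?thesis by (rule order_trans) simp
  next
    case False
    have "(real j + 1) * (coeff q j * coeff q (j + 2)) \<le> (real j + 2) * (coeff q j * coeff q (j + 2))"
      using False by (intro mult_right_mono) auto
    also have "\<dots> \<le> (real j + 1) * (coeff q (j + 1))\<^sup>2" by fact
    finally show ?thesis by (rule mult_left_le_imp_le) auto
  qed
qed

section \<open>Elementary symmetric functions and the Garding cone\<close>

text \<open>The generating function of the elementary symmetric functions of \<open>l\<close> on \<open>S\<close>; subsets \<open>S\<close> of the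
index set are needed in order to delete single entries.\<close>

definition sympoly :: "('n \<Rightarrow> real) \<Rightarrow> 'n set \<Rightarrow> real poly" where
  "sympoly l S = (\<Prod>i\<in>S. [:1, l i:])"

lemma sympoly_split: "finite S \<Longrightarrow> real_split (sympoly l S)"
proof (induction rule: finite_induct)
  case empty
  then show ?case using real_split.const[of 1] by (simp add: sympoly_def one_pCons)
next
  case (insert x F)
  then show ?case using real_split.factor[of 1 "l x"] by (simp add: sympoly_def)
qed

lemma sympoly_0: "coeff (sympoly l S) 0 = 1"
  by (simp add: sympoly_def poly_0_coeff_0[symmetric] poly_prod)

lemma sympoly_remove:
  assumes "finite S" "i \<in> S"
  shows "coeff (sympoly l S) (Suc j) =
    coeff (sympoly l (S - {i})) (Suc j) + l i * coeff (sympoly l (S - {i})) j"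
proof -
  have "sympoly l S = [:1, l i:] * sympoly l (S - {i})"
    unfolding sympoly_def by (rule prod.remove) fact+
  then show ?thesis by (simp only: coeff_linear_mult mult_1)
qed

text \<open>Deleting one entry \<open>\<lambda>\<^sub>i\<close> maps the cone \<open>\<Gamma>\<^sub>k\<close> into \<open>\<Gamma>\<^bsub>k-1\<^esub>\<close>, that is, \<open>\<partial>\<sigma>\<^sub>j/\<partial>\<lambda>\<^sub>i > 0\<close> on \<open>\<Gamma>\<^sub>k\<close> for \<open>j \<le> k\<close>. Let \<open>s\<^sub>j\<close> be
the symmetric functions of the remaining entries, so that \<open>\<sigma>\<^bsub>j+1\<^esub> = s\<^bsub>j+1\<^esub> + \<lambda>\<^sub>i s\<^sub>j\<close>. If \<open>j + 2 \<le> k\<close> and \<open>s\<^sub>j > 0 \<ge> s\<^bsub>j+1\<^esub>\<close>, then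
\<open>\<sigma>\<^bsub>j+1\<^esub> > 0\<close> and \<open>\<sigma>\<^bsub>j+2\<^esub> > 0\<close> force \<open>s\<^sub>j s\<^bsub>j+2\<^esub> > s\<^bsub>j+1\<^esub>\<^sup>2\<close>, against Newton's inequality.\<close>

lemma garding_remove:
  assumes "finite S" "i \<in> S" "\<And>j. j \<in> {1..k} \<Longrightarrow> coeff (sympoly l S) j > 0" "j < k"
  shows "coeff (sympoly l (S - {i})) j > 0"
  using \<open>j < k\<close>
proof (induction j)
  case 0
  then show ?case by (simp add: sympoly_0)
next
  case (Suc j)
  define s where "s m = coeff (sympoly l (S - {i})) m" for m
  have "s j > 0" using Suc unfolding s_def by simp
  have 1: "s (Suc j) + l i * s j > 0" and 2: "s (Suc (Suc j)) + l i * s (Suc j) > 0"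
    using assms(3)[of "Suc j"] assms(3)[of "Suc (Suc j)"] Suc.prems
    unfolding sympoly_remove[OF assms(1,2)] s_def by auto
  have newton: "s j * s (Suc (Suc j)) \<le> (s (Suc j))\<^sup>2"
    using real_split_newton[OF sympoly_split, of "S - {i}" l j] assms(1) by (simp add: s_def)
  have "s (Suc j) > 0"
  proof (rule ccontr)
    assume "\<not> ?thesis"
    then have np: "- s (Suc j) \<ge> 0" by simp
    have "(s (Suc j))\<^sup>2 = (- s (Suc j)) * (- s (Suc j))" by (simp add: power2_eq_square)
    also have "\<dots> \<le> (l i * s j) * (- s (Suc j))"
      by (rule mult_right_mono) (use 1 np in auto)
    also have "\<dots> = s j * (- (l i * s (Suc j)))" by simp
    also have "\<dots> < s j * s (Suc (Suc j))"
      by (rule mult_strict_left_mono) (use 2 \<open>s j > 0\<close> in auto)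
    finally show False using newton by simp
  qed
  then show ?case by (simp add: s_def)
qed

lemma esym_coeff: "esym j \<kappa> = coeff (sympoly (($) \<kappa>) UNIV) j"
proof -
  have m: "(\<Prod>i\<in>B. monom (\<kappa> $ i) 1) = monom (\<Prod>i\<in>B. \<kappa> $ i) (card B)" if "finite B" for B
    using that by (induction B rule: finite_induct) (auto simp: mult_monom one_pCons monom_0)
  have "sympoly (($) \<kappa>) UNIV = (\<Prod>i\<in>UNIV. monom (\<kappa> $ i) 1 + 1)"
    unfolding sympoly_def by (rule prod.cong) (auto simp: monom_altdef one_pCons)
  also have "\<dots> = (\<Sum>B\<in>UNIV. monom (\<Prod>i\<in>B. \<kappa> $ i) (card B))"
    by (subst prod_add) (auto intro!: sum.cong m[unfolded One_nat_def])
  finally have "coeff (sympoly (($) \<kappa>) UNIV) j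
      = (\<Sum>B\<in>UNIV. if card B = j then \<Prod>i\<in>B. \<kappa> $ i else 0)"
    by (simp add: coeff_sum)
  also have "\<dots> = esym j \<kappa>" unfolding esym_def
    using sum.inter_filter[of UNIV "\<lambda>B. \<Prod>i\<in>B. \<kappa> $ i" "\<lambda>B. card B = j"] by simp
  finally show ?thesis by simp
qed

section \<open>Sums of principal minors\<close>

lemma det_add_rows:
  fixes a b :: "'n::finite \<Rightarrow> 'a::comm_ring_1^'n"
  shows "det (\<chi> i. a i + b i) = (\<Sum>I\<in>UNIV. det (\<chi> i. if i \<in> I then a i else b i))"
proof -
  have "finite F \<Longrightarrow> det (\<chi> i. if i \<in> F then a i + b i else c i)
      = (\<Sum>I\<in>Pow F. det (\<chi> i. if i \<in> I then a i else if i \<in> F then b i else c i))" for F c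
  proof (induction F arbitrary: c rule: finite_induct)
    case empty
    then show ?case by simp
  next
    case (insert x F)
    have "det (\<chi> i. if i \<in> insert x F then a i + b i else c i)
      = det (\<chi> i. if i = x then a i + b i else (if i \<in> F then a i + b i else c i))"
      by (intro arg_cong[of _ _ det]) (auto simp: vec_eq_iff)
    also have "\<dots> = det (\<chi> i. if i = x then a i else (if i \<in> F then a i + b i else c i))
       + det (\<chi> i. if i = x then b i else (if i \<in> F then a i + b i else c i))"
      by (rule det_row_add)
    also have "det (\<chi> i. if i = x then a i else (if i \<in> F then a i + b i else c i))
       = det (\<chi> i. if i \<in> F then a i + b i else if i = x then a i else c i)"
      using insert.hyps by (intro arg_cong[of _ _ det]) (auto simp: vec_eq_iff)
    also have "\<dots> = (\<Sum>I\<in>Pow F. det (\<chi> i. if i \<in> I then a i else if i \<in> F then b i else if i = x then a i else c i))"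
      by (rule insert.IH)
    also have "\<dots> = (\<Sum>I\<in>insert x ` Pow F. det (\<chi> i. if i \<in> I then a i else if i \<in> insert x F then b i else c i))"
    proof (subst sum.reindex)
      show "inj_on (insert x) (Pow F)" using insert.hyps by (auto simp: inj_on_def)
    qed (use insert.hyps in \<open>auto intro!: sum.cong arg_cong[of _ _ det] simp: vec_eq_iff\<close>)
    also have "det (\<chi> i. if i = x then b i else (if i \<in> F then a i + b i else c i))
       = det (\<chi> i. if i \<in> F then a i + b i else if i = x then b i else c i)"
      using insert.hyps by (intro arg_cong[of _ _ det]) (auto simp: vec_eq_iff)
    also have "\<dots> = (\<Sum>I\<in>Pow F. det (\<chi> i. if i \<in> I then a i else if i \<in> F then b i else if i = x then b i else c i))"
      by (rule insert.IH)
    also have "\<dots> = (\<Sum>I\<in>Pow F. det (\<chi> i. if i \<in> I then a i else if i \<in> insert x F then b i else c i))"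
      using insert.hyps by (intro sum.cong arg_cong[of _ _ det]) (auto simp: vec_eq_iff)
    finally show ?case
      using insert.hyps unfolding Pow_insert
      by (subst sum.union_disjoint) (auto simp: add.commute)
  qed
  from this[of UNIV] show ?thesis by (simp cong: if_cong)
qed

text \<open>The sum of the principal minors of order \<open>j\<close>, each one written as a determinant of full size. It is the
\<open>j\<close>-th elementary symmetric function of the eigenvalues as a polynomial in the matrix entries.\<close>

definition minor_sum :: "nat \<Rightarrow> real^'n^'n \<Rightarrow> real" where
  "minor_sum j A = (\<Sum>I | card I = j. det (\<chi> i. if i \<in> I then A $ i else axis i 1))"

text \<open>The polynomial \<open>x \<mapsto> det (1 + x A)\<close>, that is \<open>\<Prod>(1 + x \<kappa>\<^sub>i)\<close> for the eigenvalues \<open>\<kappa>\<^sub>i\<close> of \<open>A\<close>.\<close>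

definition det_poly :: "real^'n^'n \<Rightarrow> real poly" where
  "det_poly A = (\<Sum>I\<in>UNIV. monom (det (\<chi> i. if i \<in> I then A $ i else axis i 1)) (card I))"

lemma coeff_det_poly: "coeff (det_poly A) j = minor_sum j A"
  unfolding det_poly_def minor_sum_def
  using sum.inter_filter[of UNIV "\<lambda>I. det (\<chi> i. if i \<in> I then A $ i else axis i 1)" "\<lambda>B. card B = j"]
  by (simp add: coeff_sum)

lemma poly_det_poly: "poly (det_poly A) x = det (mat 1 + x *\<^sub>R A)"
proof -
  have "mat 1 + x *\<^sub>R A = (\<chi> i. x *\<^sub>R A $ i + axis i 1)"
    by (simp add: vec_eq_iff mat_def axis_def)
  then have "det (mat 1 + x *\<^sub>R A) = (\<Sum>I\<in>UNIV. det (\<chi> i. if i \<in> I then x *\<^sub>R A $ i else axis i 1))"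
    by (simp only: det_add_rows)
  also have "\<dots> = (\<Sum>I\<in>UNIV. x ^ card I * det (\<chi> i. if i \<in> I then A $ i else axis i 1))"
  proof (rule sum.cong[OF refl])
    fix I :: "'a set"
    have "det (\<chi> i. if i \<in> I then x *\<^sub>R A $ i else axis i 1)
      = det (\<chi> i. (if i \<in> I then x else 1) *s (if i \<in> I then A $ i else axis i 1))"
      by (intro arg_cong[of _ _ det]) (auto simp: vec_eq_iff)
    also have "\<dots> = (\<Prod>i\<in>UNIV. if i \<in> I then x else 1) * det (\<chi> i. if i \<in> I then A $ i else axis i 1)"
      by (rule det_rows_mul)
    also have "(\<Prod>i\<in>UNIV. if i \<in> I then x else 1) = x ^ card I"
      by (simp add: prod.If_cases)
    finally show "det (\<chi> i. if i \<in> I then x *\<^sub>R A $ i else axis i 1)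
      = x ^ card I * det (\<chi> i. if i \<in> I then A $ i else axis i 1)" .
  qed
  finally show ?thesis by (simp add: det_poly_def poly_sum poly_monom mult.commute)
qed

lemma det_poly_eqI:
  assumes "\<And>x. x \<noteq> 0 \<Longrightarrow> det (mat 1 + x *\<^sub>R A) = poly p x"
  shows "det_poly A = p"
proof -
  have "infinite (- {0::real})" by (simp add: infinite_UNIV_char_0 Compl_eq_Diff_UNIV)
  moreover have "- {0} \<subseteq> {x. poly (det_poly A - p) x = 0}"
    using assms by (auto simp: poly_det_poly)
  ultimately have "infinite {x. poly (det_poly A - p) x = 0}" using infinite_super by blast
  then show ?thesis using poly_roots_finite[of "det_poly A - p"] by auto
qed

text \<open>Both sides are coefficients of \<open>det (1 + x A) = (-x)\<^sup>n det (-1/x - A)\<close>.\<close>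

lemma minor_sum_eq_esym:
  fixes A :: "real^'n^'n" and \<kappa> :: "real^'n"
  assumes "\<And>t. det (mat t - A) = (\<Prod>i\<in>UNIV. t - \<kappa> $ i)"
  shows "minor_sum j A = esym j \<kappa>"
proof -
  have "det_poly A = sympoly (($) \<kappa>) UNIV"
  proof (rule det_poly_eqI)
    fix x :: real assume "x \<noteq> 0"
    then have "mat 1 + x *\<^sub>R A = (\<chi> i. (-x) *s (mat (-1/x) - A) $ i)"
      by (simp add: vec_eq_iff mat_def algebra_simps)
    then have "det (mat 1 + x *\<^sub>R A) = (\<Prod>i\<in>(UNIV::'n set). -x) * det (\<chi> i. (mat (-1/x) - A) $ i)"
      by (simp only: det_rows_mul)
    also have "det (\<chi> i. (mat (-1/x) - A) $ i) = (\<Prod>i\<in>UNIV. -1/x - \<kappa> $ i)"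
      using assms[of "-1/x"] by (simp only: vec_lambda_eta)
    also have "(\<Prod>i\<in>(UNIV::'n set). -x) * \<dots> = (\<Prod>i\<in>UNIV. (-x) * (-1/x - \<kappa> $ i))"
      by (simp only: prod.distrib)
    also have "\<dots> = (\<Prod>i\<in>UNIV. 1 + x * \<kappa> $ i)"
      using \<open>x \<noteq> 0\<close> by (intro prod.cong) (auto simp: field_simps)
    finally show "det (mat 1 + x *\<^sub>R A) = poly (sympoly (($) \<kappa>) UNIV) x"
      by (simp add: sympoly_def poly_prod)
  qed
  then show ?thesis by (simp add: coeff_det_poly[symmetric] esym_coeff)
qed

definition diag :: "real^'n \<Rightarrow> real^'n^'n" where
  "diag d = (\<chi> i j. if i = j then d $ i else 0)"

definition outer :: "real^'n \<Rightarrow> real^'n \<Rightarrow> real^'n^'n" where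
  "outer u v = (\<chi> i j. u $ i * v $ j)"

lemma det_diag: "det (diag d) = (\<Prod>i\<in>UNIV. d $ i)"
  by (subst det_diagonal) (auto simp: diag_def)

text \<open>In the expansion along the rows, a term that uses two rows of the rank-one part vanishes, since these
rows are parallel.\<close>

lemma det_diag_outer:
  fixes d u v :: "real^'n"
  shows "det (diag d + outer u v) =
    (\<Prod>i\<in>UNIV. d $ i) + (\<Sum>i\<in>UNIV. u $ i * v $ i * (\<Prod>l\<in>UNIV-{i}. d $ l))"
proof -
  let ?M = "\<lambda>I. (\<chi> i. if i \<in> I then u $ i *s v else diag d $ i) :: real^'n^'n"
  have "diag d + outer u v = (\<chi> i. u $ i *s v + diag d $ i)"
    by (simp add: vec_eq_iff outer_def)
  then have "det (diag d + outer u v) = (\<Sum>I\<in>UNIV. det (?M I))"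
    by (simp only: det_add_rows)
  also have "\<dots> = (\<Sum>I\<in>insert {} (range (\<lambda>i. {i})). det (?M I))"
  proof (rule sum.mono_neutral_right; (intro ballI)?)
    fix I :: "'n set" assume I: "I \<in> UNIV - insert {} (range (\<lambda>i. {i}))"
    then obtain i j where ij: "i \<in> I" "j \<in> I" "i \<noteq> j" by blast
    have "?M I = (\<chi> l. (if l \<in> I then u $ l else 1) *s (if l \<in> I then v else diag d $ l))"
      by (auto simp: vec_eq_iff)
    then have "det (?M I) = (\<Prod>l\<in>UNIV. if l \<in> I then u $ l else 1) * det (\<chi> l. if l \<in> I then v else diag d $ l)"
      by (simp only: det_rows_mul)
    also have "det (\<chi> l. if l \<in> I then v else diag d $ l) = 0"
      by (rule det_identical_rows[OF ij(3)]) (use ij in \<open>simp add: row_def vec_eq_iff\<close>)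
    finally show "det (?M I) = 0" by simp
  qed auto
  also have "\<dots> = det (diag d) + (\<Sum>i\<in>UNIV. det (?M {i}))"
    by (subst sum.insert) (auto simp: sum.reindex)
  also have "(\<Sum>i\<in>UNIV. det (?M {i})) = (\<Sum>i\<in>UNIV. u $ i * v $ i * (\<Prod>l\<in>UNIV-{i}. d $ l))"
  proof (rule sum.cong[OF refl])
    fix i :: 'n
    have "?M {i} = (\<chi> l. if l = i then u $ i *s v else diag d $ l)"
      by (simp add: vec_eq_iff)
    then have "det (?M {i}) = u $ i * det (\<chi> l. if l = i then v else diag d $ l)"
      by (simp only: det_row_mul)
    also have "det (\<chi> l. if l = i then v else diag d $ l)
       = (\<Sum>m\<in>UNIV. det (\<chi> l. if l = i then v $ m *s axis m 1 else diag d $ l))"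
      by (subst det_linear_row_sum[symmetric]) (simp_all add: basis_expansion cong: if_cong)
    also have "\<dots> = (\<Sum>m\<in>UNIV. if m = i then v $ i * (\<Prod>l\<in>UNIV-{i}. d $ l) else 0)"
    proof (rule sum.cong[OF refl])
      fix m
      show "det (\<chi> l. if l = i then v $ m *s axis m 1 else diag d $ l)
         = (if m = i then v $ i * (\<Prod>l\<in>UNIV-{i}. d $ l) else 0)"
      proof (cases "m = i")
        case True
        have "(\<chi> l. if l = i then v $ i *s axis i 1 else diag d $ l) = diag (\<chi> l. if l = i then v $ i else d $ l)"
          by (auto simp: vec_eq_iff diag_def axis_def)
        moreover have "(\<Prod>l\<in>UNIV. if l = i then v $ i else d $ l) = v $ i * (\<Prod>l\<in>UNIV-{i}. d $ l)"
          by (subst prod.remove[of _ i]) auto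
        ultimately show ?thesis unfolding True by (simp add: det_diag)
      next
        case False
        have "det (\<chi> l. if l = i then v $ m *s axis m 1 else diag d $ l) = 0"
          by (rule det_zero_column[of i])
            (use False in \<open>auto simp: column_def vec_eq_iff diag_def axis_def\<close>)
        then show ?thesis using False by simp
      qed
    qed
    finally show "det (?M {i}) = u $ i * v $ i * (\<Prod>l\<in>UNIV-{i}. d $ l)" by simp
  qed
  finally show ?thesis by (simp add: det_diag)
qed

text \<open>Rank-one perturbations act affinely: the coefficient of \<open>c\<close> is the derivative of \<open>\<sigma>\<^bsub>j+1\<^esub>\<close> in direction
\<open>w\<^sup>2\<close> (taken componentwise), without remainder.\<close>

lemma minor_sum_diag_outer:
  fixes d w :: "real^'n"
  shows "minor_sum (Suc j) (diag d + c *\<^sub>R outer w w) = coeff (sympoly (($) d) UNIV) (Suc j) +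
    c * (\<Sum>i\<in>UNIV. (w $ i)\<^sup>2 * coeff (sympoly (($) d) (UNIV - {i})) j)"
proof -
  have "det_poly (diag d + c *\<^sub>R outer w w) = sympoly (($) d) UNIV +
     pCons 0 (smult c (\<Sum>i\<in>UNIV. smult ((w $ i)\<^sup>2) (sympoly (($) d) (UNIV - {i}))))"
  proof (rule det_poly_eqI)
    fix x :: real
    have "mat 1 + x *\<^sub>R (diag d + c *\<^sub>R outer w w) =
        diag (\<chi> i. 1 + x * d $ i) + outer ((x * c) *\<^sub>R w) w"
      by (auto simp: vec_eq_iff diag_def outer_def mat_def algebra_simps)
    then show "det (mat 1 + x *\<^sub>R (diag d + c *\<^sub>R outer w w)) =
      poly (sympoly (($) d) UNIV +
     pCons 0 (smult c (\<Sum>i\<in>UNIV. smult ((w $ i)\<^sup>2) (sympoly (($) d) (UNIV - {i}))))) x"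
      by (simp add: det_diag_outer sympoly_def poly_prod poly_sum sum_distrib_left power2_eq_square mult_ac)
  qed
  then show ?thesis by (simp add: coeff_det_poly[symmetric] coeff_sum)
qed

lemma minor_sum_diag: "minor_sum j (diag d) = esym j d"
proof (rule minor_sum_eq_esym)
  fix t
  have "mat t - diag d = diag (\<chi> i. t - d $ i)" by (auto simp: vec_eq_iff diag_def mat_def)
  then show "det (mat t - diag d) = (\<Prod>i\<in>UNIV. t - d $ i)" by (simp add: det_diag)
qed

lemma det_orthogonal_conj:
  fixes Q M :: "real^'n^'n"
  assumes "orthogonal_matrix Q"
  shows "det (transpose Q ** M ** Q) = det M"
proof -
  have "det (transpose Q) * det Q = 1"
    using assms by (metis det_I det_mul orthogonal_matrix)
  then show ?thesis by (simp add: det_mul)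
qed

lemma minor_sum_orthogonal_conj:
  fixes Q M :: "real^'n^'n"
  assumes "orthogonal_matrix Q"
  shows "minor_sum j (transpose Q ** M ** Q) = minor_sum j M"
proof -
  have "det_poly (transpose Q ** M ** Q) = det_poly M"
  proof (rule det_poly_eqI)
    fix x :: real
    have "transpose Q ** (mat 1 + x *\<^sub>R M) ** Q = mat 1 + x *\<^sub>R (transpose Q ** M ** Q)"
    proof -
      have "(mat 1 + x *\<^sub>R M) ** Q = mat 1 ** Q + x *\<^sub>R (M ** Q)"
        by (simp only: matrix_matrix_mult_def vec_eq_iff vec_lambda_beta vector_add_component
            vector_scaleR_component distrib_right sum.distrib real_scaleR_def sum_distrib_left mult.assoc simp_thms)
      then have "transpose Q ** (mat 1 + x *\<^sub>R M) ** Q = transpose Q ** (Q + x *\<^sub>R (M ** Q))"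
        by (simp only: matrix_mul_assoc[symmetric] matrix_mul_lid)
      also have "\<dots> = transpose Q ** Q + x *\<^sub>R (transpose Q ** (M ** Q))"
        by (simp add: matrix_add_ldistrib)
          (simp add: matrix_matrix_mult_def vec_eq_iff sum_distrib_left mult_ac)
      finally show ?thesis
        using assms by (simp add: orthogonal_matrix matrix_mul_assoc)
    qed
    then show "det (mat 1 + x *\<^sub>R (transpose Q ** M ** Q)) = poly (det_poly M) x"
      using det_orthogonal_conj[OF assms, of "mat 1 + x *\<^sub>R M"] by (simp add: poly_det_poly)
  qed
  then show ?thesis by (simp add: coeff_det_poly[symmetric])
qed

section \<open>The spectral theorem for symmetric matrices\<close>

text \<open>A maximiser \<open>v\<close> of the quadratic form on the unit sphere of \<open>S\<close> is an eigenvector: if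
\<open>y = A v - m v\<close> were not zero, moving from \<open>v\<close> a little in the direction \<open>y\<close> would increase the Rayleigh quotient.\<close>

lemma rayleigh_maximizer_eigenvector:
  fixes A :: "real^'n^'n"
  assumes sym: "\<And>x y. (A *v x) \<bullet> y = x \<bullet> (A *v y)"
    and S: "subspace S" and inv: "\<And>x. x \<in> S \<Longrightarrow> A *v x \<in> S" and ne: "S \<noteq> {0}"
  shows "\<exists>v m. v \<in> S \<and> norm v = 1 \<and> A *v v = m *\<^sub>R v"
proof -
  have cont: "continuous_on (sphere 0 1 \<inter> S) (\<lambda>x. x \<bullet> (A *v x))"
    by (intro continuous_intros linear_continuous_on linear_linear[THEN iffD2] matrix_vector_mul_linear)
  have "compact (sphere 0 1 \<inter> S)"
    by (intro compact_Int_closed compact_sphere closed_subspace S)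
  moreover have "sphere 0 1 \<inter> S \<noteq> {}"
  proof -
    obtain x where x: "x \<in> S" "x \<noteq> 0" using ne S subspace_0 by blast
    then have "x /\<^sub>R norm x \<in> sphere 0 1 \<inter> S" using S by (simp add: subspace_scale)
    then show ?thesis by blast
  qed
  ultimately obtain v where v: "v \<in> sphere 0 1 \<inter> S"
    and max: "\<And>x. x \<in> sphere 0 1 \<inter> S \<Longrightarrow> x \<bullet> (A *v x) \<le> v \<bullet> (A *v v)"
    using continuous_attains_sup[OF _ _ cont] by blast
  define m where "m = v \<bullet> (A *v v)"
  have le: "x \<bullet> (A *v x) \<le> m * (x \<bullet> x)" if "x \<in> S" for x
  proof (cases "x = 0")
    case False
    have "(x /\<^sub>R norm x) \<bullet> (A *v (x /\<^sub>R norm x)) \<le> m"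
      unfolding m_def using that False S by (intro max) (simp add: subspace_scale)
    then have "(x \<bullet> (A *v x)) / (norm x * norm x) \<le> m"
      by (simp add: matrix_vector_mult_scaleR field_simps)
    then show ?thesis using False
      by (simp add: field_simps dot_square_norm power2_eq_square)
  qed simp
  define y where "y = A *v v - m *\<^sub>R v"
  have "y \<in> S" unfolding y_def using v S inv by (intro subspace_diff subspace_scale) auto
  have vv: "v \<bullet> v = 1" using v by (simp add: dot_square_norm)
  have ortho: "v \<bullet> y = 0" unfolding y_def by (simp add: inner_diff_right vv m_def)
  have Av: "A *v v = m *\<^sub>R v + y" by (simp add: y_def)
  have ineq: "2 * (y \<bullet> y) \<le> t * (m * (y \<bullet> y) - y \<bullet> (A *v y))" if "t > 0" for t
  proof -
    have "(v + t *\<^sub>R y) \<bullet> (A *v (v + t *\<^sub>R y)) \<le> m * ((v + t *\<^sub>R y) \<bullet> (v + t *\<^sub>R y))"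
      by (rule le) (use v \<open>y \<in> S\<close> S in \<open>auto intro: subspace_add subspace_scale\<close>)
    moreover have "v \<bullet> (A *v y) = y \<bullet> y"
      using sym[of v y] ortho by (simp add: Av inner_add_left)
    ultimately have "2 * t * (y \<bullet> y) + t\<^sup>2 * (y \<bullet> (A *v y)) \<le> m * t\<^sup>2 * (y \<bullet> y)"
      using ortho by (simp add: matrix_vector_right_distrib matrix_vector_mult_scaleR Av inner_add_left
          inner_add_right inner_commute vv algebra_simps power2_eq_square)
    then have "t * (2 * (y \<bullet> y)) \<le> t * (t * (m * (y \<bullet> y) - y \<bullet> (A *v y)))"
      by (simp add: algebra_simps power2_eq_square)
    then show ?thesis using that by simp
  qed
  have "y \<bullet> y \<le> 0"
  proof (rule ccontr)
    assume "\<not> y \<bullet> y \<le> 0"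
    then have pos: "y \<bullet> y > 0" by (simp only: not_le)
    define c where "c = m * (y \<bullet> y) - y \<bullet> (A *v y)"
    (* The step t = |y|^2 / (|c| + 1) makes the right-hand side t * c at most |y|^2. *)
    have "y \<bullet> y / (\<bar>c\<bar> + 1) * c \<le> y \<bullet> y / (\<bar>c\<bar> + 1) * (\<bar>c\<bar> + 1)"
      using pos by (intro mult_left_mono) auto
    also have "\<dots> = y \<bullet> y" by (simp add: add_nonneg_eq_0_iff)
    finally show False
      using ineq[of "y \<bullet> y / (\<bar>c\<bar> + 1)"] pos unfolding c_def[symmetric]
      by (simp add: add_nonneg_pos)
  qed
  then have "y = 0" by (metis inner_eq_zero_iff inner_ge_zero order_antisym)
  then show ?thesis using Av v by auto
qed

text \<open>Induction on the dimension: the orthogonal complement of an eigenvector is again invariant.\<close>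

lemma symmetric_eigenbasis_subspace:
  fixes A :: "real^'n^'n"
  assumes sym: "\<And>x y. (A *v x) \<bullet> y = x \<bullet> (A *v y)"
    and "subspace S" and "\<And>x. x \<in> S \<Longrightarrow> A *v x \<in> S"
  shows "\<exists>B. B \<subseteq> S \<and> pairwise orthogonal B \<and> (\<forall>b\<in>B. norm b = 1) \<and> S \<subseteq> span B \<and> (\<forall>b\<in>B. \<exists>m. A *v b = m *\<^sub>R b)"
  using assms(2,3)
proof (induction "dim S" arbitrary: S rule: less_induct)
  case less
  show ?case
  proof (cases "S = {0}")
    case True
    then show ?thesis by (intro exI[of _ "{}"]) auto
  next
    case False
    from rayleigh_maximizer_eigenvector[OF sym less.prems False]
    obtain v m where v: "v \<in> S" "norm v = 1" "A *v v = m *\<^sub>R v" by blast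
    have vv: "v \<bullet> v = 1" using v by (simp add: dot_square_norm)
    define T where "T = {x \<in> S. x \<bullet> v = 0}"
    have T: "subspace T"
      using less.prems(1) unfolding subspace_def T_def by (auto simp: inner_add_left)
    have "T \<subseteq> S" "v \<notin> T" unfolding T_def using vv by auto
    then have "dim T \<noteq> dim S"
      using subspace_dim_equal[OF T less.prems(1)] v(1) by auto
    then have "dim T < dim S" using dim_subset[OF \<open>T \<subseteq> S\<close>] by simp
    moreover have "A *v x \<in> T" if "x \<in> T" for x
      using that less.prems(2) v(3) unfolding T_def by (simp add: sym)
    ultimately obtain B where B: "B \<subseteq> T" "pairwise orthogonal B" "\<forall>b\<in>B. norm b = 1"
      "T \<subseteq> span B" "\<forall>b\<in>B. \<exists>m. A *v b = m *\<^sub>R b"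
      using less.hyps[OF _ T] by blast
    show ?thesis
    proof (intro exI[of _ "insert v B"] conjI)
      show "insert v B \<subseteq> S" using v B \<open>T \<subseteq> S\<close> by auto
      show "pairwise orthogonal (insert v B)"
        using B(1,2) unfolding pairwise_insert T_def orthogonal_def by (auto simp: inner_commute)
      show "S \<subseteq> span (insert v B)"
      proof
        fix x assume "x \<in> S"
        then have "x - (x \<bullet> v) *\<^sub>R v \<in> T"
          using less.prems(1) v(1) vv unfolding T_def
          by (auto intro: subspace_diff subspace_scale simp: inner_diff_left)
        then show "x \<in> span (insert v B)"
          using B(4) by (auto simp: span_insert)
      qed
      show "\<forall>b\<in>insert v B. norm b = 1" using v(2) B(3) by simp
      show "\<forall>b\<in>insert v B. \<exists>m. A *v b = m *\<^sub>R b" using v(3) B(5) by blast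
    qed
  qed
qed

lemma symmetric_matrix_diagonalizable:
  fixes A :: "real^'n^'n"
  assumes "transpose A = A"
  shows "\<exists>Q d. orthogonal_matrix Q \<and> A = transpose Q ** diag d ** Q"
proof -
  have "A *v x = x v* A" for x
    using transpose_matrix_vector[of A x] unfolding assms .
  then have sym: "(A *v x) \<bullet> y = x \<bullet> (A *v y)" for x y
    by (simp only: dot_lmul_matrix)
  obtain B where B: "pairwise orthogonal B" "\<forall>b\<in>B. norm b = 1" "UNIV \<subseteq> span B"
    "\<forall>b\<in>B. \<exists>m. A *v b = m *\<^sub>R b"
    using symmetric_eigenbasis_subspace[OF sym subspace_UNIV] by blast
  have "independent B"
    by (rule pairwise_orthogonal_independent) (use B in auto)
  then have "finite B" "card B = CARD('n)"
    using B(3) basis_card_eq_dim[of B UNIV] independent_imp_finite by (auto simp: dim_UNIV)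
  then obtain q :: "'n \<Rightarrow> real^'n" where q: "bij_betw q UNIV B"
    using finite_same_card_bij[of "UNIV :: 'n set" B, OF finite] by metis
  have qB: "q i \<in> B" for i using bij_betwE[OF q] by simp
  have "\<forall>i. \<exists>m. A *v q i = m *\<^sub>R q i" using B(4) qB by blast
  then obtain d where d: "\<And>i. A *v q i = d i *\<^sub>R q i" unfolding choice_iff by blast
  have qq: "q i \<bullet> q j = (if i = j then 1 else 0)" for i j
  proof (cases "i = j")
    case True
    then show ?thesis using B(2) qB by (simp add: dot_square_norm)
  next
    case False
    then have "q i \<noteq> q j" using q by (auto simp: bij_betw_def inj_on_def)
    then show ?thesis using B(1) qB False by (auto simp: pairwise_def orthogonal_def)
  qed
  define Q :: "real^'n^'n" where "Q = (\<chi> i. q i)"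
  have "Q ** transpose Q = mat 1"
  proof -
    have "(Q ** transpose Q) $ i $ j = q i \<bullet> q j" for i j
      by (simp add: matrix_matrix_mult_def transpose_def Q_def inner_vec_def)
    then show ?thesis by (simp add: vec_eq_iff mat_def qq)
  qed
  then have orth: "orthogonal_matrix Q"
    by (simp add: orthogonal_matrix_def matrix_left_right_inverse)
  have "A ** transpose Q = transpose Q ** diag (\<chi> i. d i)"
  proof -
    have "(A ** transpose Q) $ i $ j = (A *v q j) $ i" for i j
      by (simp add: matrix_matrix_mult_def matrix_vector_mult_def transpose_def Q_def)
    moreover have "(transpose Q ** diag (\<chi> i. d i)) $ i $ j = (d j *\<^sub>R q j) $ i" for i j
      by (simp add: matrix_matrix_mult_def transpose_def Q_def diag_def
         if_distrib[of "\<lambda>x. _ * x"] cong: if_cong)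
    ultimately show ?thesis by (simp add: vec_eq_iff d)
  qed
  then have "A ** (transpose Q ** Q) = transpose Q ** diag (\<chi> i. d i) ** Q"
    by (simp only: matrix_mul_assoc)
  then have "A = transpose Q ** diag (\<chi> i. d i) ** Q"
    using orth by (simp add: orthogonal_matrix)
  then show ?thesis using orth by blast
qed

lemma eigvals_symmetric:
  fixes A :: "real^'n^'n"
  assumes "transpose A = A"
  shows "det (mat t - A) = (\<Prod>i\<in>UNIV. t - eigvals A $ i)"
proof -
  obtain Q d where Q: "orthogonal_matrix Q" "A = transpose Q ** diag d ** Q"
    using symmetric_matrix_diagonalizable[OF assms] by blast
  have "det (mat t - A) = (\<Prod>i\<in>UNIV. t - d $ i)" for t
  proof -
    have "mat t - A = transpose Q ** diag (\<chi> i. t - d $ i) ** Q"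
    proof -
      have "diag (\<chi> i. t - d $ i) = t *\<^sub>R mat 1 - diag d"
        by (auto simp: vec_eq_iff diag_def mat_def)
      then have "transpose Q ** diag (\<chi> i. t - d $ i) ** Q = t *\<^sub>R (transpose Q ** Q) - A"
        unfolding Q(2)
        by (simp add: vec_eq_iff matrix_matrix_mult_def mat_def left_diff_distrib right_diff_distrib
          sum_subtractf sum_distrib_left mult_ac if_distrib[of "\<lambda>x. _ * x"] cong: if_cong)
      then show ?thesis using Q(1) by (simp add: orthogonal_matrix vec_eq_iff mat_def)
    qed
    then show ?thesis by (simp add: det_orthogonal_conj[OF Q(1)] det_diag)
  qed
  then have "\<forall>t. det (mat t - A) = (\<Prod>i\<in>UNIV. t - eigvals A $ i)"
    unfolding eigvals_def by (rule someI[of _ d, OF allI])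
  then show ?thesis by (rule spec)
qed

section \<open>Monotonicity in the matrix\<close>

text \<open>The eigenvalues are chosen in no particular order, so that they need not depend continuously on the
matrix; this formula makes their symmetric functions polynomials in its entries.\<close>

lemma esym_eigvals:
  assumes "transpose A = A"
  shows "esym j (eigvals A) = minor_sum j A"
  using minor_sum_eq_esym eigvals_symmetric[OF assms] by metis

text \<open>After diagonalisation of \<open>A\<close> the increment is \<open>c \<Sum>\<^sub>i w\<^sub>i\<^sup>2 \<sigma>\<^bsub>j-1\<^esub>(\<lambda>|i)\<close>, and deleting an entry of a vector in
\<open>\<Gamma>\<^sub>k\<close> leaves a vector in \<open>\<Gamma>\<^bsub>k-1\<^esub>\<close>.\<close>

lemma minor_sum_rank_one_mono:
  fixes A :: "real^'n^'n"
  assumes sym: "transpose A = A" and pos: "\<And>j. j \<in> {1..k} \<Longrightarrow> minor_sum j A > 0"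
    and "c \<ge> 0" "j \<in> {1..k}"
  shows "minor_sum j (A + c *\<^sub>R outer v v) \<ge> minor_sum j A"
proof -
  obtain Q d where Q: "orthogonal_matrix Q" "A = transpose Q ** diag d ** Q"
    using symmetric_matrix_diagonalizable[OF sym] by blast
  define w where "w = Q *v v"
  have v: "v = transpose Q *v w"
    using Q(1) by (simp add: w_def orthogonal_matrix matrix_vector_mul_assoc)
  have "A + c *\<^sub>R outer v v = transpose Q ** (diag d + c *\<^sub>R outer w w) ** Q"
  proof -
    have "transpose Q ** (c *\<^sub>R outer w w) ** Q = c *\<^sub>R outer v v"
      unfolding v by (simp add: vec_eq_iff matrix_matrix_mult_def matrix_vector_mult_def outer_def
        transpose_def sum_distrib_left sum_distrib_right sum_product mult_ac)
    moreover have "transpose Q ** (diag d + c *\<^sub>R outer w w) ** Q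
      = transpose Q ** diag d ** Q + transpose Q ** (c *\<^sub>R outer w w) ** Q"
      by (simp add: vec_eq_iff matrix_matrix_mult_def distrib_left distrib_right sum.distrib)
    ultimately show ?thesis using Q(2) by simp
  qed
  then have new: "minor_sum j (A + c *\<^sub>R outer v v) = minor_sum j (diag d + c *\<^sub>R outer w w)"
    by (simp add: minor_sum_orthogonal_conj[OF Q(1)])
  have old: "minor_sum i A = coeff (sympoly (($) d) UNIV) i" for i
    by (simp add: Q(2) minor_sum_orthogonal_conj[OF Q(1)] minor_sum_diag esym_coeff)
  obtain m where j: "j = Suc m" "m < k" using assms(4) by (cases j) auto
  have "coeff (sympoly (($) d) (UNIV - {i})) m > 0" for i
    by (rule garding_remove[OF _ _ _ j(2)]) (use pos old in auto)
  then have "0 \<le> c * (\<Sum>i\<in>UNIV. (w $ i)\<^sup>2 * coeff (sympoly (($) d) (UNIV - {i})) m)"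
    using \<open>c \<ge> 0\<close> by (intro mult_nonneg_nonneg sum_nonneg) (auto intro: less_imp_le)
  then show ?thesis
    using new old[of j] unfolding j(1) minor_sum_diag_outer by linarith
qed

text \<open>This is the ellipticity of \<open>\<sigma>\<^sub>j\<close> on matrices with eigenvalues in \<open>\<Gamma>\<^sub>k\<close>. By the spectral theorem \<open>C\<close> is a
sum of nonnegative rank-one matrices. Adding them one at a time does not decrease any \<open>\<sigma>\<^sub>j\<close> with \<open>j \<le> k\<close>, so
that the eigenvalues stay in \<open>\<Gamma>\<^sub>k\<close> and the next step is possible.\<close>

lemma minor_sum_mono:
  fixes A C :: "real^'n^'n"
  assumes symA: "transpose A = A" and pos: "\<And>j. j \<in> {1..k} \<Longrightarrow> minor_sum j A > 0"
    and symC: "transpose C = C" and psd: "\<And>x. x \<bullet> (C *v x) \<ge> 0"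
    and j: "j \<in> {1..k}"
  shows "minor_sum j (A + C) \<ge> minor_sum j A"
proof -
  obtain Q d where Q: "orthogonal_matrix Q" "C = transpose Q ** diag d ** Q"
    using symmetric_matrix_diagonalizable[OF symC] by blast
  have C: "C = (\<Sum>i\<in>UNIV. d $ i *\<^sub>R outer (Q $ i) (Q $ i))"
    unfolding Q(2) by (simp add: vec_eq_iff matrix_matrix_mult_def transpose_def diag_def outer_def
      if_distrib[of "\<lambda>x. _ * x"] mult_ac cong: if_cong)
  have d: "d $ i \<ge> 0" for i
  proof -
    let ?x = "transpose Q *v axis i 1"
    have "C *v ?x = transpose Q *v (diag d *v ((Q ** transpose Q) *v axis i 1))"
      unfolding Q(2) by (simp only: matrix_vector_mul_assoc matrix_mul_assoc)
    also have "Q ** transpose Q = mat 1" using Q(1) by (simp add: orthogonal_matrix_def)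
    finally have "?x \<bullet> (C *v ?x) = (Q *v (transpose Q *v axis i 1)) \<bullet> (diag d *v axis i 1)"
      using dot_lmul_matrix[of ?x "transpose Q" "diag d *v axis i 1"] transpose_matrix_vector[of "transpose Q" ?x]
      by simp
    also have "\<dots> = axis i 1 \<bullet> (diag d *v axis i 1)"
      using Q(1) by (simp add: matrix_vector_mul_assoc orthogonal_matrix_def del: transpose_matrix_vector)
    also have "\<dots> = d $ i"
      by (simp add: inner_axis' matrix_vector_mult_basis column_def diag_def)
    finally show ?thesis using psd[of ?x] by simp
  qed
  have "finite F \<Longrightarrow> transpose (A + (\<Sum>i\<in>F. d $ i *\<^sub>R outer (Q $ i) (Q $ i))) = A + (\<Sum>i\<in>F. d $ i *\<^sub>R outer (Q $ i) (Q $ i))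
    \<and> (\<forall>j\<in>{1..k}. minor_sum j (A + (\<Sum>i\<in>F. d $ i *\<^sub>R outer (Q $ i) (Q $ i))) \<ge> minor_sum j A)" for F
  proof (induction F rule: finite_induct)
    case empty
    then show ?case using symA by simp
  next
    case (insert i F)
    let ?B = "A + (\<Sum>i\<in>F. d $ i *\<^sub>R outer (Q $ i) (Q $ i))"
    have eq: "A + (\<Sum>i\<in>insert i F. d $ i *\<^sub>R outer (Q $ i) (Q $ i)) = ?B + d $ i *\<^sub>R outer (Q $ i) (Q $ i)"
      using insert.hyps by (simp add: add_ac)
    have B: "transpose ?B = ?B" "\<And>j. j \<in> {1..k} \<Longrightarrow> minor_sum j ?B \<ge> minor_sum j A"
      using insert.IH by auto
    have "transpose (?B + d $ i *\<^sub>R outer (Q $ i) (Q $ i)) = transpose ?B + d $ i *\<^sub>R outer (Q $ i) (Q $ i)"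
      by (simp add: vec_eq_iff transpose_def outer_def)
    moreover have "minor_sum j A \<le> minor_sum j (?B + d $ i *\<^sub>R outer (Q $ i) (Q $ i))" if "j \<in> {1..k}" for j
      using minor_sum_rank_one_mono[OF B(1) _ d that, of i "Q $ i"] B(2) pos that
      by (meson less_le_trans order_trans)
    ultimately show ?case unfolding eq B(1) by blast
  qed
  from this[of UNIV] show ?thesis using j C by auto
qed

lemma continuous_minor_sum: "continuous_on UNIV (minor_sum j :: real^'n^'n \<Rightarrow> real)"
proof -
  have "continuous_on UNIV (\<lambda>A::real^'n^'n. if i \<in> I then A $ i $ l else axis i 1 $ l)" for I i l
    by (cases "i \<in> I") (auto intro!: continuous_intros)
  then show ?thesis
    unfolding minor_sum_def det_def
    by (auto intro!: continuous_intros simp: if_distrib[of "\<lambda>v. v $ _"] cong: if_cong)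
qed

section \<open>Functions of class C2\<close>

lemma C2_D:
  fixes f :: "real^'n \<Rightarrow> real"
  assumes "C_on 2 S f"
  shows "x \<in> S \<Longrightarrow> f differentiable (at x)"
    and "x \<in> S \<Longrightarrow> partial i f differentiable (at x)"
    and "continuous_on S (partial j (partial i f))"
proof -
  have "Ck_on 2 S f" using assms by (simp add: C_on_def numeral_eq_enat)
  then have 1: "\<forall>x\<in>S. f differentiable (at x)"
    and 2: "\<forall>b\<in>Basis. (\<forall>x\<in>S. (\<lambda>x. frechet_derivative f (at x) b) differentiable (at x)) \<and>
      (\<forall>c\<in>Basis. continuous_on S (\<lambda>x. frechet_derivative (\<lambda>x. frechet_derivative f (at x) b) (at x) c))"
    by (simp_all add: numeral_2_eq_2)
  have ax: "axis i (1::real) \<in> Basis" for i :: 'n by (simp add: axis_in_Basis_iff)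
  have p: "partial i g = (\<lambda>x. frechet_derivative g (at x) (axis i 1))" for i :: 'n and g
    by (simp add: partial_def fun_eq_iff)
  show "x \<in> S \<Longrightarrow> f differentiable (at x)" using 1 by blast
  show "x \<in> S \<Longrightarrow> partial i f differentiable (at x)" using 2 ax p by simp
  show "continuous_on S (partial j (partial i f))" using 2 ax p by simp
qed

lemma C_on_subset: "C_on r S f \<Longrightarrow> T \<subseteq> S \<Longrightarrow> C_on r T f"
proof -
  have "Ck_on k S f \<Longrightarrow> T \<subseteq> S \<Longrightarrow> Ck_on k T f" for k
    by (induction k arbitrary: f) (auto intro: continuous_on_subset)
  then show "C_on r S f \<Longrightarrow> T \<subseteq> S \<Longrightarrow> C_on r T f" by (auto simp: C_on_def)
qed

lemma frechet_derivative_grad: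
  fixes f :: "real^'n \<Rightarrow> real"
  assumes "f differentiable (at x)"
  shows "frechet_derivative f (at x) \<xi> = grad f x \<bullet> \<xi>"
proof -
  have "linear (frechet_derivative f (at x))"
    using assms by (rule linear_frechet_derivative)
  then have "frechet_derivative f (at x) (\<Sum>i\<in>UNIV. (\<xi> $ i) *\<^sub>R axis i 1) = (\<Sum>i\<in>UNIV. \<xi> $ i * partial i f x)"
    by (simp add: linear_sum linear_cmul partial_def)
  also have "(\<Sum>i\<in>UNIV. (\<xi> $ i) *\<^sub>R axis i 1) = \<xi>"
    using basis_expansion[of \<xi>] by (simp add: scalar_mult_eq_scaleR)
  finally show ?thesis by (simp add: inner_vec_def grad_def mult.commute)
qed

lemma has_real_derivative_line:
  fixes f :: "real^'n \<Rightarrow> real"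
  assumes "f differentiable (at (x + s *\<^sub>R \<xi>))"
  shows "((\<lambda>s. f (x + s *\<^sub>R \<xi>)) has_real_derivative grad f (x + s *\<^sub>R \<xi>) \<bullet> \<xi>) (at s)"
proof -
  have 1: "(f has_derivative frechet_derivative f (at (x + s *\<^sub>R \<xi>))) (at (x + s *\<^sub>R \<xi>))"
    using assms by (simp add: frechet_derivative_works)
  have "((\<lambda>s. x + s *\<^sub>R \<xi>) has_derivative (\<lambda>h. h *\<^sub>R \<xi>)) (at s)"
    by (auto intro!: derivative_eq_intros)
  from has_derivative_compose[OF this 1] have "((\<lambda>s. f (x + s *\<^sub>R \<xi>)) has_derivative (\<lambda>h. h * (grad f (x + s *\<^sub>R \<xi>) \<bullet> \<xi>))) (at s)"
    by (simp add: frechet_derivative_grad[OF assms])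
  then show ?thesis by (simp add: has_field_derivative_def mult_commute_abs)
qed

lemma grad_axis: "grad f x \<bullet> axis i 1 = partial i f x"
  by (simp add: inner_axis grad_def)

text \<open>The mean value theorem applied twice, first in direction \<open>i\<close> and then in direction \<open>j\<close>.\<close>

lemma second_difference:
  fixes f :: "real^'n \<Rightarrow> real"
  assumes "C_on 2 S f" "cball x (2 * h) \<subseteq> S" "h > 0"
  shows "\<exists>\<xi>\<in>cball x (2 * h). f (x + h *\<^sub>R axis i 1 + h *\<^sub>R axis j 1) - f (x + h *\<^sub>R axis i 1)
     - f (x + h *\<^sub>R axis j 1) + f x = h * h * partial j (partial i f) \<xi>"
proof -
  let ?a = "axis i 1 :: real^'n" and ?b = "axis j 1 :: real^'n"
  have in_cb: "x + s *\<^sub>R ?a + t *\<^sub>R ?b \<in> cball x (2 * h)" if "0 \<le> s" "s \<le> h" "0 \<le> t" "t \<le> h" for s t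
  proof -
    have "norm (s *\<^sub>R ?a + t *\<^sub>R ?b) \<le> 2 * h"
      using that by (intro norm_triangle_le) simp
    moreover have "dist x (x + s *\<^sub>R ?a + t *\<^sub>R ?b) = norm (s *\<^sub>R ?a + t *\<^sub>R ?b)"
      by (subst dist_commute) (simp only: dist_norm add.assoc add_diff_cancel_left')
    ultimately show ?thesis by simp
  qed
  have in_S: "x + s *\<^sub>R ?a + t *\<^sub>R ?b \<in> S" if "0 \<le> s" "s \<le> h" "0 \<le> t" "t \<le> h" for s t
    using in_cb[OF that] assms(2) by blast
  define g where "g s = f ((x + h *\<^sub>R ?b) + s *\<^sub>R ?a) - f (x + s *\<^sub>R ?a)" for s
  have "(g has_real_derivative partial i f ((x + h *\<^sub>R ?b) + s *\<^sub>R ?a) - partial i f (x + s *\<^sub>R ?a)) (at s)"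
    if "0 \<le> s" "s \<le> h" for s
    unfolding g_def grad_axis[symmetric]
    by (intro DERIV_diff has_real_derivative_line C2_D(1)[OF assms(1)])
      (use in_S[of s h] in_S[of s 0] that assms(3) in \<open>auto simp: add_ac\<close>)
  from MVT2[OF assms(3) this] obtain s where s: "0 < s" "s < h"
    "g h - g 0 = h * (partial i f ((x + h *\<^sub>R ?b) + s *\<^sub>R ?a) - partial i f (x + s *\<^sub>R ?a))"
    by auto
  have "((\<lambda>t. partial i f ((x + s *\<^sub>R ?a) + t *\<^sub>R ?b)) has_real_derivative
     partial j (partial i f) ((x + s *\<^sub>R ?a) + t *\<^sub>R ?b)) (at t)" if "0 \<le> t" "t \<le> h" for t
    unfolding grad_axis[where i = j, symmetric]
    by (intro has_real_derivative_line C2_D(2)[OF assms(1)] in_S) (use s that in auto)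
  from MVT2[OF assms(3) this] obtain t where t: "0 < t" "t < h"
    "partial i f ((x + s *\<^sub>R ?a) + h *\<^sub>R ?b) - partial i f ((x + s *\<^sub>R ?a) + 0 *\<^sub>R ?b)
      = h * partial j (partial i f) ((x + s *\<^sub>R ?a) + t *\<^sub>R ?b)"
    by auto
  have "g h - g 0 = h * h * partial j (partial i f) (x + s *\<^sub>R ?a + t *\<^sub>R ?b)"
    using s(3) t(3) by (simp add: add_ac)
  then show ?thesis
    using in_cb[of s t] s t unfolding g_def by (intro bexI[of _ "x + s *\<^sub>R ?a + t *\<^sub>R ?b"]) (auto simp: add_ac)
qed

text \<open>The second difference on the left of the preceding lemma is symmetric in \<open>i\<close> and \<open>j\<close>; let \<open>h\<close> tend to \<open>0\<close>.\<close>

lemma hess_symmetric: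
  fixes f :: "real^'n \<Rightarrow> real"
  assumes C2: "C_on 2 S f" and "open S" "x \<in> S"
  shows "transpose (hess f x) = hess f x"
proof -
  have "partial j (partial i f) x = partial i (partial j f) x" for i j
  proof (rule ccontr)
    let ?P = "partial j (partial i f)" and ?R = "partial i (partial j f)"
    assume "?P x \<noteq> ?R x"
    define e where "e = \<bar>?P x - ?R x\<bar> / 2"
    have "e > 0" using \<open>?P x \<noteq> ?R x\<close> by (simp add: e_def)
    have "isCont ?P x" "isCont ?R x"
      using C2_D(3)[OF C2] assms(2,3) by (auto simp: continuous_on_eq_continuous_at)
    then have "\<exists>d>0. \<forall>y. dist y x < d \<longrightarrow> dist (?P y) (?P x) < e"
      "\<exists>d>0. \<forall>y. dist y x < d \<longrightarrow> dist (?R y) (?R x) < e"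
      using \<open>e > 0\<close> by (simp_all only: continuous_at_eps_delta)
    then obtain d1 d2 where d: "d1 > 0" "\<And>y. dist y x < d1 \<Longrightarrow> dist (?P y) (?P x) < e"
      "d2 > 0" "\<And>y. dist y x < d2 \<Longrightarrow> dist (?R y) (?R x) < e"
      by blast
    obtain r where r: "r > 0" "cball x r \<subseteq> S"
      using assms(2,3) open_contains_cball by blast
    define h where "h = min r (min d1 d2) / 4"
    have h: "h > 0" "2 * h \<le> r" "2 * h < d1" "2 * h < d2" using d r by (auto simp: h_def min_def)
    then have sub: "cball x (2 * h) \<subseteq> S" using r(2) by (meson order_trans subset_cball)
    obtain \<xi> where \<xi>: "\<xi> \<in> cball x (2 * h)" "f (x + h *\<^sub>R axis i 1 + h *\<^sub>R axis j 1) - f (x + h *\<^sub>R axis i 1)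
     - f (x + h *\<^sub>R axis j 1) + f x = h * h * ?P \<xi>"
      using second_difference[OF C2 sub h(1)] by blast
    obtain \<eta> where \<eta>: "\<eta> \<in> cball x (2 * h)" "f (x + h *\<^sub>R axis j 1 + h *\<^sub>R axis i 1) - f (x + h *\<^sub>R axis j 1)
     - f (x + h *\<^sub>R axis i 1) + f x = h * h * ?R \<eta>"
      using second_difference[OF C2 sub h(1)] by blast
    have "x + h *\<^sub>R axis j 1 + h *\<^sub>R axis i 1 = x + h *\<^sub>R axis i 1 + h *\<^sub>R axis j 1"
      by (simp add: add_ac)
    from \<xi>(2) \<eta>(2)[unfolded this] have "h * h * ?P \<xi> = h * h * ?R \<eta>" by linarith
    then have "?P \<xi> = ?R \<eta>" using h(1) by simp
    moreover have "dist (?P \<xi>) (?P x) < e" "dist (?R \<eta>) (?R x) < e"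
      using d(2)[of \<xi>] d(4)[of \<eta>] \<xi>(1) \<eta>(1) h by (auto simp: dist_commute)
    ultimately have "dist (?P x) (?R x) < 2 * e"
      using dist_triangle_less_add[of "?P x" "?P \<xi>" e "?R x" e] by (simp add: dist_commute)
    then show False by (simp add: e_def dist_real_def)
  qed
  then show ?thesis by (simp add: vec_eq_iff transpose_def hess_def)
qed

section \<open>Touching from one side\<close>

lemma second_derivative_test_max:
  fixes g :: "real \<Rightarrow> real"
  assumes "e > 0" and der: "\<And>s. \<bar>s\<bar> < e \<Longrightarrow> (g has_real_derivative g' s) (at s)"
    and der2: "(g' has_real_derivative D) (at 0)"
    and max: "\<And>s. \<bar>s\<bar> < e \<Longrightarrow> g s \<le> g 0"
  shows "g' 0 = 0" "D \<le> 0"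
proof -
  show zero: "g' 0 = 0"
    by (rule DERIV_local_max[OF der \<open>e > 0\<close>]) (use assms in auto)
  show "D \<le> 0"
  proof (rule ccontr)
    assume "\<not> D \<le> 0"
    then obtain d where d: "d > 0" "\<And>h. 0 < h \<Longrightarrow> h < d \<Longrightarrow> g' 0 < g' h"
      using DERIV_pos_inc_right[OF der2] by auto
    define h where "h = min d e / 2"
    have h: "0 < h" "h < d" "h < e" using d(1) \<open>e > 0\<close> by (auto simp: h_def min_def)
    have "(g has_real_derivative g' s) (at s)" if "0 \<le> s" "s \<le> h" for s
      using der[of s] that h by simp
    from MVT2[OF h(1) this] obtain z where z: "0 < z" "z < h" "g h - g 0 = h * g' z" by auto
    then have "g' z > 0" using d(2)[of z] h zero by simp
    then have "h * g' z > 0" using h by simp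
    moreover have "g h \<le> g 0" using max[of h] h by simp
    ultimately show False using z(3) by simp
  qed
qed

text \<open>The first and second order conditions at a maximum of \<open>w - \<phi> - \<delta> \<bar>x - x0\<bar>\<^sup>2\<close>, tested along each line
through \<open>y\<close>.\<close>

lemma touching_derivatives:
  fixes w \<phi> :: "real^'n \<Rightarrow> real"
  assumes w: "C_on 2 S w" and \<phi>: "C_on 2 S \<phi>" and S: "open S" "y \<in> S"
    and max: "\<And>x. x \<in> S \<Longrightarrow> w x - \<phi> x - \<delta> * (norm (x - x0))\<^sup>2 \<le> w y - \<phi> y - \<delta> * (norm (y - x0))\<^sup>2"
  shows "grad w y = grad \<phi> y + (2 * \<delta>) *\<^sub>R (y - x0)"
    and "\<xi> \<bullet> (hess w y *v \<xi>) \<le> \<xi> \<bullet> (hess \<phi> y *v \<xi>) + 2 * \<delta> * (\<xi> \<bullet> \<xi>)"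
proof -
  have "(grad w y - grad \<phi> y - (2 * \<delta>) *\<^sub>R (y - x0)) \<bullet> \<xi> = 0 \<and>
    \<xi> \<bullet> (hess w y *v \<xi>) - \<xi> \<bullet> (hess \<phi> y *v \<xi>) - 2 * \<delta> * (\<xi> \<bullet> \<xi>) \<le> 0" for \<xi>
  proof -
    obtain r where r: "r > 0" "ball y r \<subseteq> S" using S open_contains_ball by blast
    define e where "e = r / (norm \<xi> + 1)"
    have "e > 0" using r by (simp add: e_def add_nonneg_pos)
    have in_S: "y + s *\<^sub>R \<xi> \<in> S" if "\<bar>s\<bar> < e" for s
    proof -
      have "\<bar>s\<bar> * norm \<xi> \<le> \<bar>s\<bar> * (norm \<xi> + 1)" by (intro mult_left_mono) auto
      also have "\<dots> < r" using that by (simp add: e_def pos_less_divide_eq add_nonneg_pos)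
      finally show ?thesis using r(2) by (auto simp: dist_norm)
    qed
    define g where "g s = w (y + s *\<^sub>R \<xi>) - \<phi> (y + s *\<^sub>R \<xi>) - \<delta> * ((y + s *\<^sub>R \<xi> - x0) \<bullet> (y + s *\<^sub>R \<xi> - x0))" for s
    define g' where "g' s = grad w (y + s *\<^sub>R \<xi>) \<bullet> \<xi> - grad \<phi> (y + s *\<^sub>R \<xi>) \<bullet> \<xi> - 2 * \<delta> * ((y + s *\<^sub>R \<xi> - x0) \<bullet> \<xi>)" for s
    have sq: "(y + s *\<^sub>R \<xi> - x0) \<bullet> (y + s *\<^sub>R \<xi> - x0) = (y - x0) \<bullet> (y - x0) + 2 * s * ((y - x0) \<bullet> \<xi>) + s\<^sup>2 * (\<xi> \<bullet> \<xi>)" for s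
      by (simp add: inner_add_left inner_add_right inner_diff_left inner_diff_right inner_commute algebra_simps power2_eq_square)
    have der: "(g has_real_derivative g' s) (at s)" if "\<bar>s\<bar> < e" for s
    proof -
      have "((\<lambda>s. \<delta> * ((y - x0) \<bullet> (y - x0) + 2 * s * ((y - x0) \<bullet> \<xi>) + s\<^sup>2 * (\<xi> \<bullet> \<xi>))) has_real_derivative
        2 * \<delta> * ((y + s *\<^sub>R \<xi> - x0) \<bullet> \<xi>)) (at s)"
        by (auto intro!: derivative_eq_intros simp: inner_add_left inner_diff_left algebra_simps)
      then show ?thesis unfolding g_def g'_def sq
        by (intro DERIV_diff has_real_derivative_line C2_D(1)[OF w] C2_D(1)[OF \<phi>] in_S that)
    qed
    have der_grad: "((\<lambda>s. grad f (y + s *\<^sub>R \<xi>) \<bullet> \<xi>) has_real_derivative \<xi> \<bullet> (hess f y *v \<xi>)) (at 0)"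
      if "C_on 2 S f" for f
    proof -
      have "((\<lambda>s. \<Sum>i\<in>UNIV. partial i f (y + s *\<^sub>R \<xi>) * \<xi> $ i) has_real_derivative
        (\<Sum>i\<in>UNIV. (grad (partial i f) (y + 0 *\<^sub>R \<xi>) \<bullet> \<xi>) * \<xi> $ i)) (at 0)"
        by (intro DERIV_sum DERIV_cmult_right has_real_derivative_line C2_D(2)[OF that]) (simp add: S)
      moreover have "(\<Sum>i\<in>UNIV. (grad (partial i f) (y + 0 *\<^sub>R \<xi>) \<bullet> \<xi>) * \<xi> $ i) = \<xi> \<bullet> (hess f y *v \<xi>)"
        by (simp add: inner_vec_def matrix_vector_mult_def hess_def grad_def mult.commute)
      ultimately show ?thesis by (simp add: inner_vec_def grad_def)
    qed
    have "((\<lambda>s. 2 * \<delta> * ((y + s *\<^sub>R \<xi> - x0) \<bullet> \<xi>)) has_real_derivative 2 * \<delta> * (\<xi> \<bullet> \<xi>)) (at 0)"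
      by (auto intro!: derivative_eq_intros simp: inner_add_left inner_diff_left)
    then have der2: "(g' has_real_derivative \<xi> \<bullet> (hess w y *v \<xi>) - \<xi> \<bullet> (hess \<phi> y *v \<xi>) - 2 * \<delta> * (\<xi> \<bullet> \<xi>)) (at 0)"
      unfolding g'_def by (intro DERIV_diff der_grad w \<phi>)
    have "g s \<le> g 0" if "\<bar>s\<bar> < e" for s
      using max[OF in_S[OF that]] by (simp add: g_def dot_square_norm)
    from second_derivative_test_max[OF \<open>e > 0\<close> der der2 this]
    show ?thesis by (simp add: g'_def inner_diff_left)
  qed
  note * = this
  show "\<xi> \<bullet> (hess w y *v \<xi>) \<le> \<xi> \<bullet> (hess \<phi> y *v \<xi>) + 2 * \<delta> * (\<xi> \<bullet> \<xi>)" using *[of \<xi>] by simp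
  have "grad w y - grad \<phi> y - (2 * \<delta>) *\<^sub>R (y - x0) = 0" using * by (metis inner_eq_zero_iff)
  then show "grad w y = grad \<phi> y + (2 * \<delta>) *\<^sub>R (y - x0)" by (simp add: algebra_simps)
qed

text \<open>The quadratic penalty makes \<open>x0\<close> a strict maximum of the limit: the penalised limit is at most
\<open>F x0 - \<delta> r\<^sup>2\<close> on the sphere. An approximant within \<open>\<delta> r\<^sup>2/2\<close> of \<open>F\<close> therefore attains its maximum over
the closed ball in the interior.\<close>

lemma penalized_maximum:
  fixes F :: "real^'n \<Rightarrow> real" and Fn :: "nat \<Rightarrow> real^'n \<Rightarrow> real"
  assumes "r > 0" "\<delta> > 0"
    and le: "\<And>x. x \<in> cball x0 r \<Longrightarrow> F x \<le> F x0"
    and cont: "\<And>n. n \<ge> N \<Longrightarrow> continuous_on (cball x0 r) (Fn n)"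
    and unif: "uniform_limit (cball x0 r) Fn F sequentially"
  shows "\<forall>\<^sub>F n in sequentially. \<exists>y\<in>ball x0 r. \<forall>x\<in>ball x0 r.
    Fn n x - \<delta> * (norm (x - x0))\<^sup>2 \<le> Fn n y - \<delta> * (norm (y - x0))\<^sup>2"
proof -
  define \<eta> where "\<eta> = \<delta> * r\<^sup>2 / 2"
  have "\<eta> > 0" using assms(1,2) by (simp add: \<eta>_def)
  have "\<forall>\<^sub>F n in sequentially. \<forall>x\<in>cball x0 r. dist (Fn n x) (F x) < \<eta>"
    using unif \<open>\<eta> > 0\<close> by (auto simp: uniform_limit_iff)
  then show ?thesis using eventually_ge_at_top[of N]
  proof eventually_elim
    case (elim n)
    have "continuous_on (cball x0 r) (\<lambda>x. Fn n x - \<delta> * (norm (x - x0))\<^sup>2)"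
      by (intro continuous_intros cont elim)
    then obtain y where y: "y \<in> cball x0 r" and max: "\<And>x. x \<in> cball x0 r \<Longrightarrow>
      Fn n x - \<delta> * (norm (x - x0))\<^sup>2 \<le> Fn n y - \<delta> * (norm (y - x0))\<^sup>2"
      using continuous_attains_sup[of "cball x0 r" "\<lambda>x. Fn n x - \<delta> * (norm (x - x0))\<^sup>2"] \<open>r > 0\<close> by auto
    have "Fn n x0 \<le> Fn n y - \<delta> * (norm (y - x0))\<^sup>2" using max[of x0] \<open>r > 0\<close> by simp
    moreover have "\<bar>Fn n x0 - F x0\<bar> < \<eta>" "\<bar>Fn n y - F y\<bar> < \<eta>"
      using elim(1) y \<open>r > 0\<close> by (auto simp: dist_real_def)
    ultimately have "\<delta> * (norm (y - x0))\<^sup>2 < \<delta> * r\<^sup>2" using le[OF y] unfolding \<eta>_def by linarith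
    then have "norm (y - x0) < r" using assms(1,2) by (simp add: power2_less_imp_less)
    then have "y \<in> ball x0 r" by (simp add: dist_norm norm_minus_commute)
    then show ?case using max by (intro bexI[of _ y]) auto
  qed
qed

section \<open>Ellipticity and continuity of the curvature operator\<close>

lemma wfac_pos: "wfac p > 0"
  by (simp add: wfac_def add_pos_nonneg)

lemma curv_matrix_eq:
  "curv_matrix H p z = (1 / wfac p) *\<^sub>R (mat 1 + z *\<^sub>R (gam p ** H ** gam p))"
proof -
  have "(gam p ** H ** gam p) $ i $ j = (\<Sum>k\<in>UNIV. \<Sum>l\<in>UNIV. gam p $ i $ k * H $ k $ l * gam p $ l $ j)" for i j
    by (simp add: matrix_matrix_mult_def sum_distrib_right) (rule sum.swap)
  then show ?thesis by (simp add: vec_eq_iff curv_matrix_def mat_def)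
qed

lemma transpose_gam: "transpose (gam p) = gam p"
  by (simp add: vec_eq_iff transpose_def gam_def mult.commute eq_commute)

lemma transpose_curv_matrix:
  assumes "transpose H = H"
  shows "transpose (curv_matrix H p z) = curv_matrix H p z"
proof -
  have "transpose (gam p ** H ** gam p) = gam p ** H ** gam p"
    by (simp add: matrix_transpose_mul transpose_gam assms matrix_mul_assoc)
  then show ?thesis unfolding curv_matrix_eq by (simp add: vec_eq_iff transpose_def mat_def eq_commute)
qed

text \<open>The curvature matrix depends on the Hessian through \<open>(z/w) \<gamma> H \<gamma>\<close>, which is increasing in \<open>H\<close> since
\<open>z > 0\<close> and \<open>\<gamma>\<close> is symmetric.\<close>

lemma minor_sum_curv_matrix_mono:
  assumes "transpose H\<^sub>1 = H\<^sub>1" "transpose H\<^sub>2 = H\<^sub>2" "z > 0"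
    and le: "\<And>\<xi>. \<xi> \<bullet> (H\<^sub>1 *v \<xi>) \<le> \<xi> \<bullet> (H\<^sub>2 *v \<xi>)"
    and pos: "\<And>j. j \<in> {1..k} \<Longrightarrow> minor_sum j (curv_matrix H\<^sub>1 p z) > 0" and "j \<in> {1..k}"
  shows "minor_sum j (curv_matrix H\<^sub>1 p z) \<le> minor_sum j (curv_matrix H\<^sub>2 p z)"
proof -
  define C where "C = curv_matrix H\<^sub>2 p z - curv_matrix H\<^sub>1 p z"
  have C: "C = (z / wfac p) *\<^sub>R (gam p ** (H\<^sub>2 - H\<^sub>1) ** gam p)"
    unfolding C_def curv_matrix_eq
    by (simp add: vec_eq_iff matrix_matrix_mult_def sum_subtractf left_diff_distrib right_diff_distrib diff_divide_distrib add_divide_distrib)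
  have "transpose C = C"
    using transpose_curv_matrix[OF assms(1), of p z] transpose_curv_matrix[OF assms(2), of p z]
    by (simp add: C_def vec_eq_iff transpose_def)
  moreover have "x \<bullet> (C *v x) \<ge> 0" for x
  proof -
    have "gam p *v x = x v* gam p"
      using transpose_matrix_vector[of "gam p" x] unfolding transpose_gam .
    then have "(gam p *v x) \<bullet> ((H\<^sub>2 - H\<^sub>1) *v (gam p *v x)) = x \<bullet> (gam p *v ((H\<^sub>2 - H\<^sub>1) *v (gam p *v x)))"
      by (simp only: dot_lmul_matrix)
    also have "\<dots> = x \<bullet> ((gam p ** (H\<^sub>2 - H\<^sub>1) ** gam p) *v x)"
      by (simp only: matrix_vector_mul_assoc matrix_mul_assoc)
    finally have "x \<bullet> (C *v x) = z / wfac p * ((gam p *v x) \<bullet> ((H\<^sub>2 - H\<^sub>1) *v (gam p *v x)))"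
      unfolding C by (simp add: scaleR_matrix_vector_assoc[symmetric])
    moreover have "(gam p *v x) \<bullet> ((H\<^sub>2 - H\<^sub>1) *v (gam p *v x)) \<ge> 0"
      using le[of "gam p *v x"] by (simp add: matrix_vector_mult_diff_rdistrib inner_diff_right)
    ultimately show ?thesis using \<open>z > 0\<close> wfac_pos[of p] by simp
  qed
  ultimately have "minor_sum j (curv_matrix H\<^sub>1 p z) \<le> minor_sum j (curv_matrix H\<^sub>1 p z + C)"
    using minor_sum_mono[OF transpose_curv_matrix[OF assms(1)] pos] assms(6) by blast
  then show ?thesis by (simp add: C_def)
qed

lemma tendsto_minor_sum_curv_matrix:
  fixes H :: "nat \<Rightarrow> real^'n^'n"
  assumes "H \<longlonglongrightarrow> H0" "p \<longlonglongrightarrow> p0" "z \<longlonglongrightarrow> z0"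
  shows "(\<lambda>m. minor_sum j (curv_matrix (H m) (p m) (z m))) \<longlonglongrightarrow> minor_sum j (curv_matrix H0 p0 z0)"
proof -
  have w: "wfac p0 \<noteq> 0" "wfac p0 * (1 + wfac p0) \<noteq> 0" using wfac_pos[of p0] by (auto simp: add_pos_pos)
  have wl: "(\<lambda>m. wfac (p m)) \<longlonglongrightarrow> wfac p0"
    unfolding wfac_def by (intro tendsto_intros assms)
  have gl: "(\<lambda>m. gam (p m) $ i $ j) \<longlonglongrightarrow> gam p0 $ i $ j" for i j
    unfolding gam_def using assms w by (auto intro!: tendsto_intros wl)
  have "(\<lambda>m. curv_matrix (H m) (p m) (z m)) \<longlonglongrightarrow> curv_matrix H0 p0 z0"
    unfolding curv_matrix_def by (intro vec_tendstoI) (auto intro!: tendsto_intros wl gl assms w)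
  then show ?thesis
    using continuous_minor_sum[of j] by (auto simp: continuous_on_eq_continuous_at intro: isCont_tendsto_compose)
qed

section \<open>Stability of viscosity solutions\<close>

text \<open>The signs \<open>s = 1\<close> and \<open>s = -1\<close> stand for touching from above (subsolutions) and from below
(supersolutions). The parameter \<open>\<delta>\<close> is at the same time the weight of the penalty and the bound for the
distances, so that a single limit \<open>\<delta> \<rightarrow> 0\<close> will do.\<close>

lemma approximate_touching:
  fixes u \<phi> :: "real^'n \<Rightarrow> real" and v :: "nat \<Rightarrow> real^'n \<Rightarrow> real"
  assumes "open \<Omega>" "x\<^sub>0 \<in> \<Omega>" and s: "s = 1 \<or> s = -1"
    and \<phi>: "C_on 2 \<Omega> \<phi>"
    and u: "continuous_on \<Omega> u"
    and touch: "u x\<^sub>0 = \<phi> x\<^sub>0" "\<forall>\<^sub>F x in nhds x\<^sub>0. s * u x \<le> s * \<phi> x"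
    and lim: "loc_uniform_limit \<Omega> v u"
    and exhaust: "\<And>K. compact K \<Longrightarrow> K \<subseteq> \<Omega> \<Longrightarrow> \<forall>\<^sub>F n in sequentially. K \<subseteq> W n"
    and v: "\<And>n. C_on 2 (W n) (v n)"
    and "\<delta> > 0"
  shows "\<exists>n y. y \<in> W n \<and> y \<in> \<Omega> \<and> dist y x\<^sub>0 < \<delta> \<and> \<bar>v n y - u x\<^sub>0\<bar> < \<delta> \<and>
    grad (v n) y = grad \<phi> y + (s * (2 * \<delta>)) *\<^sub>R (y - x\<^sub>0) \<and>
    (\<forall>\<xi>. s * (\<xi> \<bullet> (hess (v n) y *v \<xi>)) \<le> s * (\<xi> \<bullet> (hess \<phi> y *v \<xi>)) + 2 * \<delta> * (\<xi> \<bullet> \<xi>))"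
proof -
  obtain r1 where r1: "r1 > 0" "cball x\<^sub>0 r1 \<subseteq> \<Omega>"
    using assms(1,2) open_contains_cball by blast
  obtain r2 where r2: "r2 > 0" "\<And>x. dist x x\<^sub>0 < r2 \<Longrightarrow> s * u x \<le> s * \<phi> x"
    using touch(2) unfolding eventually_nhds_metric by blast
  have "isCont u x\<^sub>0" using u assms(1,2) by (simp add: continuous_on_eq_continuous_at)
  then obtain r3 where r3: "r3 > 0" "\<And>x. dist x x\<^sub>0 < r3 \<Longrightarrow> dist (u x) (u x\<^sub>0) < \<delta> / 2"
    unfolding continuous_at_eps_delta using \<open>\<delta> > 0\<close> half_gt_zero by blast
  define r where "r = min (min r1 r2) (min r3 \<delta>) / 2"
  have r: "r > 0" "r \<le> r1" "r < r2" "r < r3" "r < \<delta>"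
    using r1(1) r2(1) r3(1) \<open>\<delta> > 0\<close> by (auto simp: r_def min_def)
  have sub: "cball x\<^sub>0 r \<subseteq> \<Omega>" using r1(2) r(2) by (meson order_trans subset_cball)
  obtain N where N: "\<And>n. n \<ge> N \<Longrightarrow> cball x\<^sub>0 r \<subseteq> W n"
    using exhaust[OF compact_cball sub] unfolding eventually_sequentially by blast
  have unif: "uniform_limit (cball x\<^sub>0 r) v u sequentially"
    using lim sub unfolding loc_uniform_limit_def by (simp add: compact_cball)
  have C0: "continuous_on S f" if "C_on 2 S f" for S and f :: "real^'n \<Rightarrow> real"
    using C2_D(1)[OF that] by (auto intro!: continuous_at_imp_continuous_on differentiable_imp_continuous_within)
  have cont: "continuous_on (cball x\<^sub>0 r) (\<lambda>x. s * (v n x - \<phi> x))" if "n \<ge> N" for n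
    by (intro continuous_intros continuous_on_subset[OF C0[OF v] N[OF that]] continuous_on_subset[OF C0[OF \<phi>] sub])
  have "uniform_limit (cball x\<^sub>0 r) (\<lambda>n x. s * (v n x - \<phi> x)) (\<lambda>x. s * (u x - \<phi> x)) sequentially"
    using unif s by (auto simp: uniform_limit_iff dist_real_def abs_minus_commute)
  moreover have "s * (u x - \<phi> x) \<le> s * (u x\<^sub>0 - \<phi> x\<^sub>0)" if "x \<in> cball x\<^sub>0 r" for x
    using r2(2)[of x] that r touch(1) by (simp add: dist_commute right_diff_distrib)
  ultimately have "\<forall>\<^sub>F n in sequentially. \<exists>y\<in>ball x\<^sub>0 r. \<forall>x\<in>ball x\<^sub>0 r.
    s * (v n x - \<phi> x) - \<delta> * (norm (x - x\<^sub>0))\<^sup>2 \<le> s * (v n y - \<phi> y) - \<delta> * (norm (y - x\<^sub>0))\<^sup>2"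
    using penalized_maximum[of r \<delta> x\<^sub>0 "\<lambda>x. s * (u x - \<phi> x)" N "\<lambda>n x. s * (v n x - \<phi> x)"]
      r(1) \<open>\<delta> > 0\<close> cont by blast
  moreover have "\<forall>\<^sub>F n in sequentially. \<forall>x\<in>cball x\<^sub>0 r. dist (v n x) (u x) < \<delta> / 2"
    by (rule uniform_limitD[OF unif]) (use \<open>\<delta> > 0\<close> in simp)
  ultimately have "\<forall>\<^sub>F n in sequentially. n \<ge> N \<and> (\<exists>y\<in>ball x\<^sub>0 r. \<forall>x\<in>ball x\<^sub>0 r.
    s * (v n x - \<phi> x) - \<delta> * (norm (x - x\<^sub>0))\<^sup>2 \<le> s * (v n y - \<phi> y) - \<delta> * (norm (y - x\<^sub>0))\<^sup>2)
    \<and> (\<forall>x\<in>cball x\<^sub>0 r. dist (v n x) (u x) < \<delta> / 2)"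
    using eventually_ge_at_top[of N] by eventually_elim blast
  then obtain n y where n: "n \<ge> N" and y: "y \<in> ball x\<^sub>0 r" and max: "\<And>x. x \<in> ball x\<^sub>0 r \<Longrightarrow>
    s * (v n x - \<phi> x) - \<delta> * (norm (x - x\<^sub>0))\<^sup>2 \<le> s * (v n y - \<phi> y) - \<delta> * (norm (y - x\<^sub>0))\<^sup>2"
    and close: "\<And>x. x \<in> cball x\<^sub>0 r \<Longrightarrow> dist (v n x) (u x) < \<delta> / 2"
    unfolding eventually_sequentially by blast
  have "ball x\<^sub>0 r \<subseteq> cball x\<^sub>0 r" by auto
  then have C2: "C_on 2 (ball x\<^sub>0 r) (v n)" "C_on 2 (ball x\<^sub>0 r) \<phi>"
    using C_on_subset[OF v] C_on_subset[OF \<phi>] N[OF n] sub by (meson order_trans)+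
  have "\<bar>v n y - u y\<bar> < \<delta> / 2" "\<bar>u y - u x\<^sub>0\<bar> < \<delta> / 2"
    using close[of y] r3(2)[of y] y r by (auto simp: dist_real_def dist_commute)
  then have "\<bar>v n y - u x\<^sub>0\<bar> < \<delta>" by linarith
  moreover have "grad (v n) y = grad \<phi> y + (s * (2 * \<delta>)) *\<^sub>R (y - x\<^sub>0) \<and>
    (\<forall>\<xi>. s * (\<xi> \<bullet> (hess (v n) y *v \<xi>)) \<le> s * (\<xi> \<bullet> (hess \<phi> y *v \<xi>)) + 2 * \<delta> * (\<xi> \<bullet> \<xi>))"
    using s
  proof
    assume "s = 1"
    then show ?thesis
      using touching_derivatives[OF C2 open_ball y, of \<delta> x\<^sub>0] max by simp
  next
    assume "s = -1"
    then have max': "\<And>x. x \<in> ball x\<^sub>0 r \<Longrightarrow> \<phi> x - v n x - \<delta> * (norm (x - x\<^sub>0))\<^sup>2 \<le> \<phi> y - v n y - \<delta> * (norm (y - x\<^sub>0))\<^sup>2"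
      using max by fastforce
    show ?thesis
      using touching_derivatives[OF C2(2,1) open_ball y max'] \<open>s = -1\<close> by (simp add: algebra_simps)
  qed
  moreover have "y \<in> W n" "y \<in> \<Omega>" "dist y x\<^sub>0 < \<delta>"
    using y N[OF n] sub r by (auto simp: dist_commute)
  ultimately show ?thesis by blast
qed

lemma symmetric_add_scaled_identity:
  fixes M :: "real^'n^'n"
  assumes "transpose M = M"
  shows "transpose (M + c *\<^sub>R mat 1) = M + c *\<^sub>R mat 1"
  using assms by (simp add: vec_eq_iff transpose_def mat_def)

lemma quadratic_form_add_scaled_identity:
  fixes M :: "real^'n^'n"
  shows "\<xi> \<bullet> ((M + c *\<^sub>R mat 1) *v \<xi>) = \<xi> \<bullet> (M *v \<xi>) + c * (\<xi> \<bullet> \<xi>)"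
  by (simp add: matrix_vector_mult_add_rdistrib scaleR_matrix_vector_assoc[symmetric] inner_add_right)

lemma tendsto_grad_hess:
  fixes f :: "real^'n \<Rightarrow> real"
  assumes C2: "C_on 2 S f" and S: "open S" "x \<in> S" and y: "y \<longlonglongrightarrow> x"
  shows "(\<lambda>m. grad f (y m)) \<longlonglongrightarrow> grad f x" "(\<lambda>m. hess f (y m)) \<longlonglongrightarrow> hess f x"
proof -
  have "isCont (partial i f) x" for i
    using C2_D(2)[OF C2 S(2)] by (rule differentiable_imp_continuous_within)
  then show "(\<lambda>m. grad f (y m)) \<longlonglongrightarrow> grad f x"
    unfolding grad_def by (intro vec_tendstoI) (simp add: isCont_tendsto_compose[OF _ y])
  have "isCont (partial j (partial i f)) x" for i j
    using C2_D(3)[OF C2] S by (simp add: continuous_on_eq_continuous_at)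
  then show "(\<lambda>m. hess f (y m)) \<longlonglongrightarrow> hess f x"
    unfolding hess_def by (intro vec_tendstoI) (simp add: isCont_tendsto_compose[OF _ y])
qed

lemma esym_kappa:
  assumes "C_on 2 S f" "open S" "x \<in> S"
  shows "esym j (kappa f x) = minor_sum j (curv_matrix (hess f x) (grad f x) (f x))"
  unfolding kappa_def
  by (rule esym_eigvals[OF transpose_curv_matrix[OF hess_symmetric[OF assms]]])

text \<open>With \<open>\<delta> = 1/(m+1)\<close> in \<open>approximate_touching\<close>, the matrix \<open>B m\<close> is the Hessian of \<open>\<phi>\<close> at \<open>y m\<close> plus
\<open>2 s \<delta>\<close> times the identity. It is compared with the Hessian of the approximant at the gradient and the
value of the approximant, which makes the two curvature matrices comparable; the resulting curvatures
converge to those of \<open>\<phi>\<close> at \<open>x\<^sub>0\<close>.\<close>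

lemma touching_limit:
  fixes u \<phi> :: "real^'n \<Rightarrow> real" and v :: "nat \<Rightarrow> real^'n \<Rightarrow> real"
  assumes \<Omega>: "open \<Omega>" "x\<^sub>0 \<in> \<Omega>" and s: "s = 1 \<or> s = -1"
    and \<phi>: "C_on 2 \<Omega> \<phi>"
    and u: "continuous_on \<Omega> u"
    and touch: "u x\<^sub>0 = \<phi> x\<^sub>0" "\<forall>\<^sub>F x in nhds x\<^sub>0. s * u x \<le> s * \<phi> x"
    and lim: "loc_uniform_limit \<Omega> v u"
    and exhaust: "\<And>K. compact K \<Longrightarrow> K \<subseteq> \<Omega> \<Longrightarrow> \<forall>\<^sub>F n in sequentially. K \<subseteq> W n"
    and v: "\<And>n. C_on 2 (W n) (v n)"
  obtains n y and B :: "nat \<Rightarrow> real^'n^'n" where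
    "\<And>m. y m \<in> W (n m)" "y \<longlonglongrightarrow> x\<^sub>0" "(\<lambda>m. v (n m) (y m)) \<longlonglongrightarrow> \<phi> x\<^sub>0"
    "\<And>m. transpose (B m) = B m"
    "\<And>m \<xi>. s * (\<xi> \<bullet> (hess (v (n m)) (y m) *v \<xi>)) \<le> s * (\<xi> \<bullet> (B m *v \<xi>))"
    "\<And>j. (\<lambda>m. minor_sum j (curv_matrix (B m) (grad (v (n m)) (y m)) (v (n m) (y m))))
      \<longlonglongrightarrow> esym j (kappa \<phi> x\<^sub>0)"
proof -
  define \<delta> where "\<delta> m = inverse (real (Suc m))" for m
  have \<delta>: "\<delta> m > 0" "\<delta> \<longlonglongrightarrow> 0" for m
    unfolding \<delta>_def by (simp, rule LIMSEQ_inverse_real_of_nat)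
  define P where "P m n y \<longleftrightarrow> y \<in> W n \<and> y \<in> \<Omega> \<and> dist y x\<^sub>0 < \<delta> m \<and> \<bar>v n y - u x\<^sub>0\<bar> < \<delta> m \<and>
    grad (v n) y = grad \<phi> y + (s * (2 * \<delta> m)) *\<^sub>R (y - x\<^sub>0) \<and>
    (\<forall>\<xi>. s * (\<xi> \<bullet> (hess (v n) y *v \<xi>)) \<le> s * (\<xi> \<bullet> (hess \<phi> y *v \<xi>)) + 2 * \<delta> m * (\<xi> \<bullet> \<xi>))"
    for m n y
  have "\<exists>n y. P m n y" for m
    unfolding P_def
    by (rule approximate_touching[OF \<Omega> s \<phi> u touch lim _ v \<delta>(1)]) (rule exhaust)
  then obtain n y where "\<And>m. P m (n m) (y m)" by metis
  then have ny: "\<And>m. y m \<in> W (n m)" "\<And>m. y m \<in> \<Omega>" "\<And>m. dist (y m) x\<^sub>0 < \<delta> m"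
    "\<And>m. \<bar>v (n m) (y m) - u x\<^sub>0\<bar> < \<delta> m"
    "\<And>m. grad (v (n m)) (y m) = grad \<phi> (y m) + (s * (2 * \<delta> m)) *\<^sub>R (y m - x\<^sub>0)"
    "\<And>m \<xi>. s * (\<xi> \<bullet> (hess (v (n m)) (y m) *v \<xi>)) \<le> s * (\<xi> \<bullet> (hess \<phi> (y m) *v \<xi>)) + 2 * \<delta> m * (\<xi> \<bullet> \<xi>)"
    unfolding P_def by blast+
  define B where "B m = hess \<phi> (y m) + (s * (2 * \<delta> m)) *\<^sub>R mat 1" for m
  have "(\<lambda>m. dist (y m) x\<^sub>0) \<longlonglongrightarrow> 0"
    by (rule tendsto_sandwich[OF _ _ tendsto_const \<delta>(2)]) (auto intro!: always_eventually less_imp_le ny(3))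
  then have y: "y \<longlonglongrightarrow> x\<^sub>0" by (rule tendsto_dist_iff[THEN iffD2])
  have "(\<lambda>m. \<bar>v (n m) (y m) - u x\<^sub>0\<bar>) \<longlonglongrightarrow> 0"
    by (rule tendsto_sandwich[OF _ _ tendsto_const \<delta>(2)]) (auto intro!: always_eventually less_imp_le ny(4))
  then have z: "(\<lambda>m. v (n m) (y m)) \<longlonglongrightarrow> \<phi> x\<^sub>0"
    unfolding touch(1) by (rule LIM_zero_cancel[OF tendsto_rabs_zero_cancel])
  note D = tendsto_grad_hess[OF \<phi> \<Omega> y]
  have "(\<lambda>m. grad \<phi> (y m) + (s * (2 * \<delta> m)) *\<^sub>R (y m - x\<^sub>0)) \<longlonglongrightarrow> grad \<phi> x\<^sub>0 + (s * (2 * 0)) *\<^sub>R (x\<^sub>0 - x\<^sub>0)"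
    by (intro tendsto_intros D y \<delta>(2))
  then have p: "(\<lambda>m. grad (v (n m)) (y m)) \<longlonglongrightarrow> grad \<phi> x\<^sub>0" by (simp add: ny(5))
  have "B \<longlonglongrightarrow> hess \<phi> x\<^sub>0 + (s * (2 * 0)) *\<^sub>R mat 1"
    unfolding B_def by (intro tendsto_intros D \<delta>(2))
  then have B: "B \<longlonglongrightarrow> hess \<phi> x\<^sub>0" by simp
  show thesis
  proof (rule that[of y n B])
    show "transpose (B m) = B m" for m
      unfolding B_def by (intro symmetric_add_scaled_identity hess_symmetric[OF \<phi>] \<Omega> ny)
    show "s * (\<xi> \<bullet> (hess (v (n m)) (y m) *v \<xi>)) \<le> s * (\<xi> \<bullet> (B m *v \<xi>))" for m \<xi>
      using ny(6)[of \<xi> m] s unfolding B_def quadratic_form_add_scaled_identity by (auto simp: algebra_simps)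
    show "(\<lambda>m. minor_sum j (curv_matrix (B m) (grad (v (n m)) (y m)) (v (n m) (y m)))) \<longlonglongrightarrow> esym j (kappa \<phi> x\<^sub>0)" for j
      unfolding esym_kappa[OF \<phi> \<Omega>] by (rule tendsto_minor_sum_curv_matrix[OF B p z])
  qed (use ny y z in auto)
qed

text \<open>Ellipticity is used with the smaller Hessian in the Garding cone. For a test function from above this
is the Hessian of the approximant, which is admissible; for a test function from below it is the Hessian \<open>B m\<close>, which
enters the open cone in the limit because the test function is assumed admissible at \<open>x\<^sub>0\<close>.\<close>

lemma viscosity_solution_of_loc_uniform_limit:
  fixes \<psi> :: "(real^'n) \<times> real \<Rightarrow> real" and u :: "real^'n \<Rightarrow> real" and v :: "nat \<Rightarrow> real^'n \<Rightarrow> real"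
  assumes "1 \<le> k" and \<Omega>: "open \<Omega>"
    and psi_cont: "continuous_on halfspace \<psi>" and psi_pos: "\<And>q. q \<in> halfspace \<Longrightarrow> 0 < \<psi> q"
    and exhaust: "\<And>K. compact K \<Longrightarrow> K \<subseteq> \<Omega> \<Longrightarrow> \<forall>\<^sub>F n in sequentially. K \<subseteq> W n"
    and W: "\<And>n. open (W n)"
    and adm: "\<And>n. admissible_on k (W n) (v n)"
    and eq: "\<And>n x. x \<in> W n \<Longrightarrow> curv_fun k (kappa (v n) x) = \<psi> (x, v n x)"
    and u: "continuous_on \<Omega> u" "\<And>x. x \<in> \<Omega> \<Longrightarrow> 0 < u x"
    and lim: "loc_uniform_limit \<Omega> v u"
  shows "viscosity_solution k \<psi> \<Omega> u"
proof -
  have C2: "C_on 2 (W n) (v n)" for n using adm by (simp add: admissible_on_def)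
  have vpos: "0 < v n x" "\<And>j. j \<in> {1..k} \<Longrightarrow> 0 < esym j (kappa (v n) x)" if "x \<in> W n" for n x
    using adm that by (auto simp: admissible_on_def admissible_at_def garding_cone_def)
  have kk: "k \<in> {1..k}" "k > 0" using \<open>1 \<le> k\<close> by auto
  have eqk: "esym k (kappa (v n) x) = \<psi> (x, v n x) ^ k" if "x \<in> W n" for n x
    using eq[OF that] vpos(2)[OF that kk(1)] kk(2)
    by (metis curv_fun_def less_imp_le real_root_pow_pos2)
  have psi_lim: "(\<lambda>m. \<psi> (y m, z m) ^ k) \<longlonglongrightarrow> \<psi> (x, z0) ^ k" if "y \<longlonglongrightarrow> x" "z \<longlonglongrightarrow> z0" "z0 > 0"
    for y :: "nat \<Rightarrow> real^'n" and x z z0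
  proof -
    have "open (halfspace :: ((real^'n) \<times> real) set)"
      unfolding halfspace_def by (intro open_Collect_less continuous_intros)
    then have "isCont \<psi> (x, z0)"
      using psi_cont that(3) by (simp add: continuous_on_eq_continuous_at halfspace_def)
    then show ?thesis
      by (intro tendsto_power isCont_tendsto_compose[of "(x, z0)" \<psi>] tendsto_Pair that)
  qed
  have sub: "viscosity_subsolution k \<psi> \<Omega> u"
    unfolding viscosity_subsolution_def
  proof (intro conjI allI impI ballI; (elim conjE)?)
    fix \<phi> x\<^sub>0
    assume \<phi>: "C_on 2 \<Omega> \<phi>" and x0: "x\<^sub>0 \<in> \<Omega>" and touch: "u x\<^sub>0 = \<phi> x\<^sub>0" "\<forall>\<^sub>F x in nhds x\<^sub>0. u x \<le> \<phi> x"
    have touch1: "\<forall>\<^sub>F x in nhds x\<^sub>0. 1 * u x \<le> 1 * \<phi> x" using touch(2) by simp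
    obtain n y and B :: "nat \<Rightarrow> real^'n^'n" where *:
      "\<And>m. y m \<in> W (n m)" "y \<longlonglongrightarrow> x\<^sub>0" "(\<lambda>m. v (n m) (y m)) \<longlonglongrightarrow> \<phi> x\<^sub>0"
      "\<And>m. transpose (B m) = B m"
      "\<And>m \<xi>. 1 * (\<xi> \<bullet> (hess (v (n m)) (y m) *v \<xi>)) \<le> 1 * (\<xi> \<bullet> (B m *v \<xi>))"
      "\<And>j. (\<lambda>m. minor_sum j (curv_matrix (B m) (grad (v (n m)) (y m)) (v (n m) (y m))))
        \<longlonglongrightarrow> esym j (kappa \<phi> x\<^sub>0)"
      by (rule touching_limit[OF \<Omega> x0 _ \<phi> u(1) touch(1) touch1 lim exhaust C2])
        (simp, assumption, assumption, rule that)
    define A where "A m = hess (v (n m)) (y m)" for m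
    define p where "p m = grad (v (n m)) (y m)" for m
    have symA: "transpose (A m) = A m" for m
      unfolding A_def by (rule hess_symmetric[OF C2 W *(1)])
    have A: "minor_sum j (curv_matrix (A m) (p m) (v (n m) (y m))) = esym j (kappa (v (n m)) (y m))" for j m
      unfolding esym_kappa[OF C2 W *(1)] A_def p_def ..
    note le = *(5)[folded A_def] and conv = *(6)[folded p_def]
    have "\<psi> (y m, v (n m) (y m)) ^ k \<le> minor_sum k (curv_matrix (B m) (p m) (v (n m) (y m)))" for m
    proof -
      have "minor_sum k (curv_matrix (A m) (p m) (v (n m) (y m))) \<le> minor_sum k (curv_matrix (B m) (p m) (v (n m) (y m)))"
        by (rule minor_sum_curv_matrix_mono[OF symA *(4) vpos(1)[OF *(1)] _ _ kk(1)])
          (use le vpos(2)[OF *(1)] A in auto)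
      then show ?thesis by (simp add: A eqk[OF *(1)])
    qed
    then have le_k: "\<psi> (x\<^sub>0, \<phi> x\<^sub>0) ^ k \<le> esym k (kappa \<phi> x\<^sub>0)"
      using psi_lim[OF *(2,3)] u(2)[OF x0] touch(1) conv[of k] by (intro LIMSEQ_le) auto
    have pos: "0 < \<psi> (x\<^sub>0, \<phi> x\<^sub>0)" using psi_pos u(2)[OF x0] touch(1) by (simp add: halfspace_def)
    show "0 \<le> esym k (kappa \<phi> x\<^sub>0)" using le_k pos by (meson less_le_trans less_imp_le zero_less_power)
    show "\<psi> (x\<^sub>0, \<phi> x\<^sub>0) \<le> G k (hess \<phi> x\<^sub>0) (grad \<phi> x\<^sub>0) (\<phi> x\<^sub>0)"
      using real_root_le_mono[OF kk(2) le_k] real_root_power_cancel[OF kk(2) less_imp_le[OF pos]]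
      by (simp add: G_def curv_fun_def kappa_def)
  qed (use u in auto)
  have super: "viscosity_supersolution k \<psi> \<Omega> u"
    unfolding viscosity_supersolution_def
  proof (intro conjI allI impI ballI; (elim conjE)?)
    fix \<phi> x\<^sub>0
    assume \<phi>: "C_on 2 \<Omega> \<phi>" and x0: "x\<^sub>0 \<in> \<Omega>" and touch: "u x\<^sub>0 = \<phi> x\<^sub>0" "\<forall>\<^sub>F x in nhds x\<^sub>0. \<phi> x \<le> u x"
    have touch1: "\<forall>\<^sub>F x in nhds x\<^sub>0. -1 * u x \<le> -1 * \<phi> x" using touch(2) by simp
    obtain n y and B :: "nat \<Rightarrow> real^'n^'n" where *:
      "\<And>m. y m \<in> W (n m)" "y \<longlonglongrightarrow> x\<^sub>0" "(\<lambda>m. v (n m) (y m)) \<longlonglongrightarrow> \<phi> x\<^sub>0"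
      "\<And>m. transpose (B m) = B m"
      "\<And>m \<xi>. -1 * (\<xi> \<bullet> (hess (v (n m)) (y m) *v \<xi>)) \<le> -1 * (\<xi> \<bullet> (B m *v \<xi>))"
      "\<And>j. (\<lambda>m. minor_sum j (curv_matrix (B m) (grad (v (n m)) (y m)) (v (n m) (y m))))
        \<longlonglongrightarrow> esym j (kappa \<phi> x\<^sub>0)"
      by (rule touching_limit[OF \<Omega> x0 _ \<phi> u(1) touch(1) touch1 lim exhaust C2])
        (simp, assumption, assumption, rule that)
    define A where "A m = hess (v (n m)) (y m)" for m
    define p where "p m = grad (v (n m)) (y m)" for m
    have symA: "transpose (A m) = A m" for m
      unfolding A_def by (rule hess_symmetric[OF C2 W *(1)])
    have A: "minor_sum j (curv_matrix (A m) (p m) (v (n m) (y m))) = esym j (kappa (v (n m)) (y m))" for j m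
      unfolding esym_kappa[OF C2 W *(1)] A_def p_def ..
    note le = *(5)[folded A_def] and conv = *(6)[folded p_def]
    show "\<not> admissible_at k \<phi> x\<^sub>0 \<or> G k (hess \<phi> x\<^sub>0) (grad \<phi> x\<^sub>0) (\<phi> x\<^sub>0) \<le> \<psi> (x\<^sub>0, \<phi> x\<^sub>0)"
    proof (cases "admissible_at k \<phi> x\<^sub>0")
      case True
      then have pos: "\<And>j. j \<in> {1..k} \<Longrightarrow> 0 < esym j (kappa \<phi> x\<^sub>0)"
        by (simp add: admissible_at_def garding_cone_def)
      have "\<forall>\<^sub>F m in sequentially. \<forall>j\<in>{1..k}. 0 < minor_sum j (curv_matrix (B m) (p m) (v (n m) (y m)))"
        by (intro eventually_ball_finite ballI order_tendstoD(1)[OF conv] pos) simp_all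
      then have "\<forall>\<^sub>F m in sequentially. minor_sum k (curv_matrix (B m) (p m) (v (n m) (y m))) \<le> \<psi> (y m, v (n m) (y m)) ^ k"
      proof eventually_elim
        case (elim m)
        have "minor_sum k (curv_matrix (B m) (p m) (v (n m) (y m))) \<le> minor_sum k (curv_matrix (A m) (p m) (v (n m) (y m)))"
          by (rule minor_sum_curv_matrix_mono[OF *(4) symA vpos(1)[OF *(1)] _ _ kk(1)])
            (use le elim in auto)
        then show ?case by (simp add: A eqk[OF *(1)])
      qed
      then have le_k: "esym k (kappa \<phi> x\<^sub>0) \<le> \<psi> (x\<^sub>0, \<phi> x\<^sub>0) ^ k"
        using psi_lim[OF *(2,3)] u(2)[OF x0] touch(1) conv[of k]
        by (intro tendsto_le[OF sequentially_bot]) auto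
      have "0 < \<psi> (x\<^sub>0, \<phi> x\<^sub>0)" using psi_pos u(2)[OF x0] touch(1) by (simp add: halfspace_def)
      then show ?thesis
        using real_root_le_mono[OF kk(2) le_k] real_root_power_cancel[OF kk(2) less_imp_le]
        by (simp add: G_def curv_fun_def kappa_def)
    qed simp
  qed (use u in auto)
  show ?thesis using sub super by (simp add: viscosity_solution_def)
qed

theorem proposition7p5:
  fixes k :: nat
    and \<psi> :: "(real^'n) \<times> real \<Rightarrow> real"
    and \<Gamma> :: "(real^'n) set set"
    and \<Omega> :: "(real^'n) set"
    and ul u :: "real^'n \<Rightarrow> real"
    and \<epsilon> :: "nat \<Rightarrow> real"
    and v :: "nat \<Rightarrow> real^'n \<Rightarrow> real"
  assumes k: "1 \<le> k" "k \<le> CARD('n)"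
    and psi_smooth: "C_on \<infinity> halfspace \<psi>"
    and psi_pos: "\<forall>p\<in>halfspace. 0 < \<psi> p"
    and domain: "encloses \<Gamma> \<Omega>"
    and ul_reg: "C_on 4 \<Omega> ul" "continuous_on (closure \<Omega>) ul"
    and ul_adm: "admissible_on k \<Omega> ul"
    and ul_sub: "\<forall>x\<in>\<Omega>. curv_fun k (kappa ul x) \<ge> \<psi> (x, ul x)"
    and ul_bdry: "\<forall>x\<in>\<Union>\<Gamma>. ul x = 0"
    and regular: "\<forall>\<^sub>F e in at_right 0. regular_level \<Omega> ul e"
    and cond_a: "k < CARD('n) \<Longrightarrow>
      \<forall>(x, z)\<in>halfspace. deriv (\<lambda>s. \<psi> (x, s)) z - \<psi> (x, z) / z \<ge> 0"
    and cond_b: "k < CARD('n) \<Longrightarrow>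
      \<exists>U. open U \<and> \<Union>\<Gamma> \<subseteq> U \<and> (\<forall>x\<in>U \<inter> \<Omega>. - eigvals (hess ul x) \<in> garding_cone (k + 1))"
    and cond_c: "k < CARD('n) \<Longrightarrow> \<forall>\<^sub>F e in at_right 0. compatible_at k \<psi> \<Omega> ul e"
    and eps: "\<And>i. 0 < \<epsilon> i" "decseq \<epsilon>" "\<epsilon> \<longlonglongrightarrow> 0"
    and v_smooth: "\<And>i. smooth_on_closure (superlevel \<Omega> ul (\<epsilon> i)) (v i)"
    and v_sol: "\<And>i. admissible_solution_above k \<Omega> ul (\<epsilon> i) (\<lambda>x z. \<psi> (x, z)) (v i)"
    and u_reg: "loc_lipschitz \<Omega> u" "continuous_on (closure \<Omega>) u"
    and u_lim: "loc_uniform_limit \<Omega> v u"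
  shows "viscosity_solution k \<psi> \<Omega> u"
proof -
  let ?W = "\<lambda>i. superlevel \<Omega> ul (\<epsilon> i)"
  have \<Omega>: "open \<Omega>" using domain by (simp add: encloses_def)
  have ul_cont: "continuous_on \<Omega> ul"
    using ul_reg(2) closure_subset by (rule continuous_on_subset)
  have ul_pos: "0 < ul x" if "x \<in> \<Omega>" for x
    using ul_adm that by (simp add: admissible_on_def admissible_at_def)
  have psi_cont: "continuous_on halfspace \<psi>"
  proof -
    have "Ck_on 0 halfspace \<psi>" using psi_smooth unfolding C_on_def by (metis enat_ord_code(3))
    then show ?thesis by simp
  qed
  have W: "open (?W i)" for i
  proof -
    have "?W i = \<Omega> \<inter> ul -` {\<epsilon> i<..}" by (auto simp: superlevel_def)
    then show ?thesis using continuous_open_preimage[OF ul_cont \<Omega> open_greaterThan] by simp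
  qed
  (* ul is bounded below by a positive constant on compact sets, and the levels tend to 0. *)
  have exhaust: "\<forall>\<^sub>F i in sequentially. K \<subseteq> ?W i" if K: "compact K" "K \<subseteq> \<Omega>" for K
  proof (cases "K = {}")
    case False
    obtain a where a: "a \<in> K" "\<And>x. x \<in> K \<Longrightarrow> ul a \<le> ul x"
      using continuous_attains_inf[OF K(1) False continuous_on_subset[OF ul_cont K(2)]] by blast
    have "\<forall>\<^sub>F i in sequentially. \<epsilon> i < ul a"
      using order_tendstoD(2)[OF eps(3)] ul_pos a(1) K(2) by blast
    then show ?thesis
      by eventually_elim (use a K(2) in \<open>force simp: superlevel_def\<close>)
  qed simp
  have sol: "admissible_on k (?W i) (v i)"
    "\<And>x. x \<in> ?W i \<Longrightarrow> curv_fun k (kappa (v i) x) = \<psi> (x, v i x)"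
    "\<And>x. x \<in> ?W i \<Longrightarrow> ul x \<le> v i x" for i
    using v_sol[of i] closure_subset unfolding admissible_solution_above_def by blast+
  (* The lower barrier ul keeps the limit away from 0 inside the domain. *)
  have u_pos: "0 < u x" if "x \<in> \<Omega>" for x
  proof -
    have "uniform_limit {x} v u sequentially"
      using u_lim[unfolded loc_uniform_limit_def, rule_format, of "{x}"] that by simp
    then have "(\<lambda>i. v i x) \<longlonglongrightarrow> u x" by (rule tendsto_uniform_limitI) simp
    moreover have "\<forall>\<^sub>F i in sequentially. ul x \<le> v i x"
      using exhaust[of "{x}"] that sol(3) by (auto elim: eventually_mono)
    ultimately have "ul x \<le> u x" by (intro tendsto_lowerbound) auto
    then show ?thesis using ul_pos[OF that] by simp
  qed
  show ?thesis
  proof (rule viscosity_solution_of_loc_uniform_limit[OF k(1) \<Omega> psi_cont _ _ W sol(1,2)])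
    show "continuous_on \<Omega> u" using u_reg(2) closure_subset by (rule continuous_on_subset)
  qed (use psi_pos exhaust u_pos u_lim in auto)
qed

end
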